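(* Let $M^4\subset\mathbb{C}^3$ be a connected $4$-dimensional CR-generic submanifold belonging to the General Class II, of smoothness $\mathcal{C}^\kappa$ with $\kappa\geqslant 3$, or $\mathcal{C}^\infty$, or $\mathcal{C}^\omega$, with its biholomorphically invariant $(1,0)$ CR bundle $T^{1,0}M\subset\mathbb{C}\otimes_{\mathbb{R}}TM$. For any choice of local vector field generator $\mathcal{L}$ of $T^{1,0}M$, the associated fields $$\big\{\mathcal{L},\ \overline{\mathcal{L}},\ \mathcal{T},\ \mathcal{S}\big\},\qquad \mathcal{T}:=\sqrt{-1}\,[\mathcal{L},\overline{\mathcal{L}}],\quad \mathcal{S}:=[\mathcal{L},\mathcal{T}],$$ form a local frame for $\mathbb{C}\otimes_{\mathbb{R}}TM$, and these frames perform a reduction of the full $\mathsf{GL}_4(\mathbb{C})$-structure of $\mathbb{C}\otimes_{\mathbb{R}}TM$ to the subgroup of real dimension $10$ $$\mathsf{G}_{\mathsf{II}}^{\mathsf{initial}}:=\left\{\begin{pmatrix}\mathsf{a}&0&0&0\\0&\overline{\mathsf{a}}&0&0\\ \mathsf{b}&\overline{\mathsf{b}}&\mathsf{a}\overline{\mathsf{a}}&0\\ \mathsf{e}&\mathsf{d}&\mathsf{c}&\mathsf{a}\mathsf{a}\overline{\mathsf{a}}\end{pmatrix}:\ \mathsf{a}\in\mathbb{C}\setminus\{0\},\ \mathsf{b},\mathsf{c},\mathsf{d},\mathsf{e}\in\mathbb{C}\right\}\subset\mathsf{GL}_4(\mathbb{C}).$$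
   Context: A real submanifold $M\subset\mathbb{C}^n$ is CR-generic if $TM+J\,TM=T\mathbb{C}^n|_M$, $J$ being the complex structure. $T^{1,0}M\subset\mathbb{C}\otimes_{\mathbb{R}}TM$ is the bundle of $(1,0)$ vectors tangent to $M$ and $T^{0,1}M=\overline{T^{1,0}M}$. For CR-generic $M^4\subset\mathbb{C}^3$, $T^{1,0}M$ has complex rank $1$; a local generator $\mathcal{L}$ is a nowhere vanishing local section, taken of the natural smoothness of the bundle ($\mathcal{C}^{\kappa-1}$, resp. $\mathcal{C}^\infty$, $\mathcal{C}^\omega$). General Class II: $M^4\subset\mathbb{C}^3$ belongs to it if $\mathbb{C}\otimes_{\mathbb{R}}TM=T^{1,0}M+T^{0,1}M+[T^{1,0}M,T^{0,1}M]+[T^{1,0}M,[T^{1,0}M,T^{0,1}M]]$, i.e. for any local generator $\mathcal{L}$ of $T^{1,0}M$, the vectors $\mathcal{L},\overline{\mathcal{L}},[\mathcal{L},\overline{\mathcal{L}}],[\mathcal{L},[\mathcal{L},\overline{\mathcal{L}}]]$ have complex rank $4$ at every point where $\mathcal{L}$ is defined. "These frames perform a reduction of the full $\mathsf{GL}$-structure to a subgroup $\mathsf{G}$" means: $\mathsf{G}$ is a closed subgroup of the general linear group, and for any two local generators defined on a common open subset $V\subset M$, the two associated frames, written as column vectors, are related at each point of $V$ by left multiplication by a matrix belonging to $\mathsf{G}$ (with entries functions on $V$). *)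

theory Defs
  imports "HOL-Analysis.Analysis" "HOL-Algebra.Group"
begin

section \<open>Differentiability classes\<close>

datatype smoothness = Ck nat | Cinf | Comega

fun drop_class :: "smoothness \<Rightarrow> nat \<Rightarrow> smoothness" where
  "drop_class (Ck k) j = Ck (k - j)"
| "drop_class Cinf j = Cinf"
| "drop_class Comega j = Comega"

text \<open>The predicates \<open>ck_on\<close>, \<open>real_analytic_on\<close> and \<open>class_on\<close> are only meant for an open
  set \<open>U\<close>.\<close>

primrec ck_on ::
  "nat \<Rightarrow> 'a::euclidean_space set \<Rightarrow> ('a \<Rightarrow> 'b::real_normed_vector) \<Rightarrow> bool" where
  "ck_on 0 U f \<longleftrightarrow> continuous_on U f"
| "ck_on (Suc k) U f \<longleftrightarrow>
     (\<forall>x\<in>U. f differentiable (at x)) \<and> (\<forall>v. ck_on k U (\<lambda>x. frechet_derivative f (at x) v))"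

text \<open>Local power series expansions in the coordinates given by \<open>Basis\<close>; a multi-index is a
  function \<open>\<alpha>\<close> vanishing off \<open>Basis\<close>.\<close>

definition real_analytic_on ::
  "'a::euclidean_space set \<Rightarrow> ('a \<Rightarrow> 'b::real_normed_vector) \<Rightarrow> bool" where
  "real_analytic_on U f \<longleftrightarrow>
     (\<forall>p\<in>U. \<exists>r>0. \<exists>c :: ('a \<Rightarrow> nat) \<Rightarrow> 'b. \<forall>x\<in>ball p r.
        ((\<lambda>\<alpha>. (\<Prod>b\<in>Basis. ((x - p) \<bullet> b) ^ \<alpha> b) *\<^sub>R c \<alpha>) has_sum f x)
          {\<alpha>. \<forall>b. b \<notin> Basis \<longrightarrow> \<alpha> b = 0})"

definition class_on ::
  "smoothness \<Rightarrow> 'a::euclidean_space set \<Rightarrow> ('a \<Rightarrow> 'b::real_normed_vector) \<Rightarrow> bool" where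
  "class_on \<kappa> U f \<longleftrightarrow> (case \<kappa> of
       Ck k \<Rightarrow> ck_on k U f
     | Cinf \<Rightarrow> (\<forall>k. ck_on k U f)
     | Comega \<Rightarrow> (\<forall>k. ck_on k U f) \<and> real_analytic_on U f)"

definition class_on_subset ::
  "smoothness \<Rightarrow> 'a::euclidean_space set \<Rightarrow> ('a \<Rightarrow> 'b::real_normed_vector) \<Rightarrow> bool" where
  "class_on_subset \<kappa> V f \<longleftrightarrow>
     (\<forall>p\<in>V. \<exists>U F. open U \<and> p \<in> U \<and> class_on \<kappa> U F \<and> (\<forall>q\<in>U \<inter> V. F q = f q))"


section \<open>Embedded submanifolds and tangent spaces\<close>

definition submanifold :: "smoothness \<Rightarrow> nat \<Rightarrow> 'a::euclidean_space set \<Rightarrow> bool" where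
  "submanifold \<kappa> d M \<longleftrightarrow>
     (\<forall>p\<in>M. \<exists>U W (\<Phi> :: 'a \<Rightarrow> 'a) \<Psi> E.
        open U \<and> p \<in> U \<and> open W \<and> homeomorphism U W \<Phi> \<Psi> \<and>
        class_on \<kappa> U \<Phi> \<and> class_on \<kappa> W \<Psi> \<and>
        subspace E \<and> dim E = d \<and> \<Phi> ` (U \<inter> M) = W \<inter> E)"

definition tangent_space :: "'a::euclidean_space set \<Rightarrow> 'a \<Rightarrow> 'a set" where
  "tangent_space M p =
     {v. \<exists>\<gamma> \<epsilon>. \<epsilon> > 0 \<and> class_on (Ck 1) {-\<epsilon><..<\<epsilon>} \<gamma> \<and> \<gamma> ` {-\<epsilon><..<\<epsilon>} \<subseteq> M \<and>
           \<gamma> 0 = p \<and> (\<gamma> has_vector_derivative v) (at (0::real))}"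


section \<open>Complexification\<close>

text \<open>The complexification of a real vector space is modelled by pairs: \<open>(u, v)\<close> stands for
  \<open>u + \<i> v\<close>. The factor \<open>\<i>\<close> here is unrelated to the complex structure \<open>J\<close> below.\<close>

definition cscale :: "complex \<Rightarrow> 'a::real_vector \<times> 'a \<Rightarrow> 'a \<times> 'a" (infixr "*\<^sub>C" 75) where
  "c *\<^sub>C X = (Re c *\<^sub>R fst X - Im c *\<^sub>R snd X, Im c *\<^sub>R fst X + Re c *\<^sub>R snd X)"

global_interpretation cplx: vector_space "cscale :: complex \<Rightarrow> 'a::real_vector \<times> 'a \<Rightarrow> 'a \<times> 'a"
  by unfold_locales (auto simp: cscale_def algebra_simps)

definition cconj :: "'a::real_vector \<times> 'a \<Rightarrow> 'a \<times> 'a" where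
  "cconj X = (fst X, - snd X)"

definition ctangent_space :: "'a::euclidean_space set \<Rightarrow> 'a \<Rightarrow> ('a \<times> 'a) set" where
  "ctangent_space M p = tangent_space M p \<times> tangent_space M p"


section \<open>Complex vector fields on a submanifold and their brackets\<close>

text \<open>\<open>covariant M X Y p\<close> is the derivative of the vector-valued function \<open>Y\<close> along the complex
  vector \<open>X p\<close>, extended complex linearly in \<open>X p\<close>. A derivative \<open>at p within M\<close> is determined only
  on vectors tangent to \<open>M\<close>, hence this is meaningful exactly for \<open>X p \<in> ctangent_space M p\<close>. If \<open>V\<close>
  is relatively open in \<open>M\<close> and contains \<open>p\<close>, then \<open>at p within M\<close> and \<open>at p within V\<close> coincide, so
  that fields defined only on \<open>V\<close> are covered. The bracket is the usual commutator in the
  coordinates of the ambient space.\<close>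

definition covariant ::
  "'a::euclidean_space set \<Rightarrow> ('a \<Rightarrow> 'a \<times> 'a) \<Rightarrow> ('a \<Rightarrow> 'a \<times> 'a) \<Rightarrow> 'a \<Rightarrow> 'a \<times> 'a" where
  "covariant M X Y p =
     frechet_derivative Y (at p within M) (fst (X p)) +
     \<i> *\<^sub>C frechet_derivative Y (at p within M) (snd (X p))"

definition lie_bracket ::
  "'a::euclidean_space set \<Rightarrow> ('a \<Rightarrow> 'a \<times> 'a) \<Rightarrow> ('a \<Rightarrow> 'a \<times> 'a) \<Rightarrow> 'a \<Rightarrow> 'a \<times> 'a" where
  "lie_bracket M X Y p = covariant M X Y p - covariant M Y X p"

text \<open>\<open>F p $ i\<close> is the value at \<open>p\<close> of the \<open>i\<close>-th field of the frame.\<close>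

definition local_frame ::
  "smoothness \<Rightarrow> 'a::euclidean_space set \<Rightarrow> 'a set \<Rightarrow> ('a \<Rightarrow> ('a \<times> 'a) ^ 'k) \<Rightarrow> bool" where
  "local_frame \<kappa> M V F \<longleftrightarrow>
     (\<forall>i. class_on_subset \<kappa> V (\<lambda>p. F p $ i)) \<and>
     (\<forall>p\<in>V. inj (\<lambda>i. F p $ i) \<and> cplx.independent (range (\<lambda>i. F p $ i)) \<and>
             cplx.span (range (\<lambda>i. F p $ i)) = ctangent_space M p)"


section \<open>CR structure\<close>

definition J :: "complex ^ 'n \<Rightarrow> complex ^ 'n" where
  "J v = \<i> *s v"

definition CR_generic :: "(complex ^ 'n) set \<Rightarrow> bool" where
  "CR_generic M \<longleftrightarrow>
     (\<forall>p\<in>M. {u + J v | u v. u \<in> tangent_space M p \<and> v \<in> tangent_space M p} = UNIV)"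

definition T10 :: "(complex ^ 'n) set \<Rightarrow> complex ^ 'n \<Rightarrow> ((complex ^ 'n) \<times> (complex ^ 'n)) set" where
  "T10 M p = {X \<in> ctangent_space M p. (J (fst X), J (snd X)) = \<i> *\<^sub>C X}"

text \<open>Meant for a bundle \<open>T10 M\<close> of complex rank 1, over a relatively open subset \<open>V\<close> of \<open>M\<close>, where
  \<open>M\<close> has class \<open>\<kappa>\<close>.\<close>

definition local_generator ::
  "smoothness \<Rightarrow> (complex ^ 'n) set \<Rightarrow> (complex ^ 'n) set \<Rightarrow>
     (complex ^ 'n \<Rightarrow> (complex ^ 'n) \<times> (complex ^ 'n)) \<Rightarrow> bool" where
  "local_generator \<kappa> M V L \<longleftrightarrow>
     openin (top_of_set M) V \<and> class_on_subset (drop_class \<kappa> 1) V L \<and>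
     (\<forall>p\<in>V. L p \<in> T10 M p \<and> L p \<noteq> 0)"

definition general_class_II :: "smoothness \<Rightarrow> (complex ^ 3) set \<Rightarrow> bool" where
  "general_class_II \<kappa> M \<longleftrightarrow>
     (\<forall>V L. local_generator \<kappa> M V L \<longrightarrow>
        (let Lbar = (\<lambda>p. cconj (L p));
             B = lie_bracket M L Lbar
         in \<forall>p\<in>V. cplx.dim {L p, Lbar p, B p, lie_bracket M L B p} = 4))"

definition associated_frame ::
  "(complex ^ 'n) set \<Rightarrow> (complex ^ 'n \<Rightarrow> (complex ^ 'n) \<times> (complex ^ 'n)) \<Rightarrow>
     complex ^ 'n \<Rightarrow> ((complex ^ 'n) \<times> (complex ^ 'n)) ^ 4" where
  "associated_frame M L =
     (let Lbar = (\<lambda>p. cconj (L p));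
          T = (\<lambda>p. \<i> *\<^sub>C lie_bracket M L Lbar p);
          S = lie_bracket M L T
      in (\<lambda>p. vector [L p, Lbar p, T p, S p]))"


section \<open>Reduction of the structure group\<close>

definition GL :: "(complex ^ 'k ^ 'k) monoid" where
  "GL = \<lparr>carrier = {A. invertible A}, mult = (**), one = mat 1\<rparr>"

definition mat_act :: "complex ^ 'k ^ 'k \<Rightarrow> ('a::real_vector \<times> 'a) ^ 'k \<Rightarrow> ('a \<times> 'a) ^ 'k" where
  "mat_act g F = (\<chi> i. \<Sum>j\<in>UNIV. g $ i $ j *\<^sub>C F $ j)"

definition frames_reduce_to ::
  "smoothness \<Rightarrow> (complex ^ 3) set \<Rightarrow> (complex ^ 4 ^ 4) set \<Rightarrow> bool" where
  "frames_reduce_to \<kappa> M G \<longleftrightarrow>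
     subgroup G GL \<and> closedin (top_of_set (carrier GL)) G \<and>
     (\<forall>V L L'. local_generator \<kappa> M V L \<and> local_generator \<kappa> M V L' \<longrightarrow>
        (\<exists>g. \<forall>p\<in>V. g p \<in> G \<and>
           associated_frame M L' p = mat_act (g p) (associated_frame M L p)))"

definition G_II_initial :: "(complex ^ 4 ^ 4) set" where
  "G_II_initial =
     {vector [vector [a,     0,     0,             0],
              vector [0,     cnj a, 0,             0],
              vector [b,     cnj b, a * cnj a,     0],
              vector [e,     d,     c,             a * a * cnj a]] | a b c d e. a \<noteq> 0}"

end

(* A second generator of the rank one bundle T10 is L' = a L, and the Leibniz rule for the bracket gives
   T' = a cnj a T + cnj b cnj L + b L with b = - i cnj a (cnj L)(a), and S' = a a cnj a S + (L, cnj L, T terms),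
   so the frames are related by G_II_initial. The fields of the frame are tangent to M because a
   bracket of tangent fields is tangent (symmetry of second derivatives in a flattening chart);
   being independent by the Class II condition, they span by a dimension count. All computations are
   done with extensions of the fields to open subsets of the ambient space: on tangent vectors the
   derivative relative to M does not depend on the choice made by frechet_derivative. *)

theory Submission
  imports Defs
begin

section \<open>Functions of class C^k\<close>

text \<open>The generator has class \<kappa> - 1 and S differentiates it twice, hence the frame
  class \<kappa> - 3 and the bound \<kappa> \<ge> 3. For analytic \<kappa> the brackets must be
  analytic again; as analyticity means local power series expansions, products and termwise
  derivatives of such series have to be controlled by estimates. The factor \<i> makes T equal to
  its own conjugate. This is why the coefficients of L and cnj L in T' are conjugate to each other,
  while S has no such reality and its coefficients stay unrelated. The function a is at first only a
  ratio at each point of V, but T' contains its first derivatives and S' its second ones. A (1,0)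
  vector has the form u - \<i> J u and is determined by u; near a point, a is therefore the quotient
  of one coordinate of u' by the same coordinate of u, computed from ambient extensions, and
  inherits their class C^2. The real dimension of the group is established by exhibiting it as an
  embedded submanifold of the space of all 4 x 4 matrices.\<close>

lemma ck_on_subset: "ck_on k U f \<Longrightarrow> V \<subseteq> U \<Longrightarrow> ck_on k V f"
  by (induction k arbitrary: f) (auto intro: continuous_on_subset)

text \<open>Differentiability and the derivative chosen by \<open>frechet_derivative\<close> depend
  on the germ only. Openness of \<open>U\<close> thus lets the derivative of a compound function be
  replaced by an explicit formula valid on \<open>U\<close>.\<close>

lemma ck_on_cong:
  assumes "open U" "\<And>x. x \<in> U \<Longrightarrow> f x = g x"
  shows "ck_on k U f \<longleftrightarrow> ck_on k U g"
  using assms(2)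
proof (induction k arbitrary: f g)
  case 0
  then show ?case by (simp cong: continuous_on_cong)
next
  case (Suc k)
  have d: "f differentiable (at x) \<longleftrightarrow> g differentiable (at x)" if "x \<in> U" for x
    unfolding differentiable_def using Suc.prems assms(1) that
    by (metis has_derivative_transform_within_open)
  have e: "frechet_derivative f (at x) = frechet_derivative g (at x)" if "x \<in> U" for x
    unfolding frechet_derivative_def using Suc.prems assms(1) that
    by (metis has_derivative_transform_within_open)
  have "ck_on k U (\<lambda>x. frechet_derivative f (at x) v) \<longleftrightarrow>
    ck_on k U (\<lambda>x. frechet_derivative g (at x) v)" for v
    by (rule Suc.IH) (simp add: e)
  then show ?case using d by simp
qed

lemma ck_on_Suc_continuous: "ck_on (Suc k) U f \<Longrightarrow> continuous_on U f"
  by (simp add: continuous_at_imp_continuous_on differentiable_imp_continuous_within)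

lemma ck_on_SucD: "ck_on (Suc k) U f \<Longrightarrow> ck_on k U f"
proof (induction k arbitrary: f)
  case 0
  then show ?case using ck_on_Suc_continuous[of 0] by simp
next
  case (Suc k)
  then show ?case by simp
qed

lemma ck_on_le: "j \<le> k \<Longrightarrow> ck_on k U f \<Longrightarrow> ck_on j U f"
  by (induction k rule: dec_induct) (blast intro: ck_on_SucD)+

lemma ck_on_const: "ck_on k U (\<lambda>x. c)"
proof (induction k arbitrary: c)
  case (Suc k)
  have "ck_on k U (\<lambda>x. 0 :: 'b)" by (rule Suc)
  then show ?case by (simp del: ck_on.simps add: ck_on.simps(2))
qed (simp add: continuous_on_const)

text \<open>Pattern of the closure lemmas below: on \<open>U\<close> the derivative of the compound
  is built from the operands and their derivatives, the induction hypothesis applies to it, and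
  \<open>ck_on_cong\<close> carries the result over to \<open>frechet_derivative\<close>.\<close>

lemma ck_on_bounded_linear:
  assumes "bounded_linear h" "open U"
  shows "ck_on k U f \<Longrightarrow> ck_on k U (\<lambda>x. h (f x))"
proof (induction k arbitrary: f)
  case 0
  then show ?case
    using assms(1) by (auto intro: bounded_linear.continuous_on)
next
  case (Suc k)
  have d: "((\<lambda>x. h (f x)) has_derivative (\<lambda>v. h (frechet_derivative f (at x) v))) (at x)"
    if "x \<in> U" for x
    using Suc.prems that
    by (intro bounded_linear.has_derivative[OF assms(1)]) (simp add: frechet_derivative_works)
  have "ck_on k U (\<lambda>x. frechet_derivative (\<lambda>x. h (f x)) (at x) v)" for v
  proof -
    have "ck_on k U (\<lambda>x. h (frechet_derivative f (at x) v))"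
      using Suc.prems by (intro Suc.IH) simp
    then show ?thesis
      by (subst ck_on_cong[OF assms(2)]) (simp_all add: frechet_derivative_at[OF d, symmetric])
  qed
  then show ?case using d by (auto simp: differentiable_def)
qed

lemma ck_on_add:
  assumes "open U"
  shows "ck_on k U f \<Longrightarrow> ck_on k U g \<Longrightarrow> ck_on k U (\<lambda>x. f x + g x)"
proof (induction k arbitrary: f g)
  case 0
  then show ?case by (simp add: continuous_on_add)
next
  case (Suc k)
  have d: "((\<lambda>x. f x + g x) has_derivative
      (\<lambda>v. frechet_derivative f (at x) v + frechet_derivative g (at x) v)) (at x)"
    if "x \<in> U" for x
    using Suc.prems that by (intro has_derivative_add) (simp_all add: frechet_derivative_works)
  have "ck_on k U (\<lambda>x. frechet_derivative (\<lambda>x. f x + g x) (at x) v)" for v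
  proof -
    have "ck_on k U (\<lambda>x. frechet_derivative f (at x) v + frechet_derivative g (at x) v)"
      using Suc.prems by (intro Suc.IH) simp_all
    then show ?thesis
      by (subst ck_on_cong[OF assms]) (simp_all add: frechet_derivative_at[OF d, symmetric])
  qed
  then show ?case using d by (auto simp: differentiable_def)
qed

text \<open>Each summand of the product rule keeps one factor undifferentiated;
  \<open>ck_on_SucD\<close> lowers its order to match the other one. Stated for any bilinear map, so
  as to serve real, complex and \<open>cscale\<close> products alike.\<close>

lemma ck_on_bilinear:
  assumes "bounded_bilinear h" "open U"
  shows "ck_on k U f \<Longrightarrow> ck_on k U g \<Longrightarrow> ck_on k U (\<lambda>x. h (f x) (g x))"
proof (induction k arbitrary: f g)
  case 0
  then show ?case using assms(1) by (simp add: bounded_bilinear.continuous_on)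
next
  case (Suc k)
  have d: "((\<lambda>x. h (f x) (g x)) has_derivative
      (\<lambda>v. h (f x) (frechet_derivative g (at x) v) + h (frechet_derivative f (at x) v) (g x))) (at x)"
    if "x \<in> U" for x
    using Suc.prems that
    by (intro bounded_bilinear.FDERIV[OF assms(1)]) (simp_all add: frechet_derivative_works)
  have "ck_on k U (\<lambda>x. frechet_derivative (\<lambda>x. h (f x) (g x)) (at x) v)" for v
  proof -
    have "ck_on k U (\<lambda>x. h (f x) (frechet_derivative g (at x) v) + h (frechet_derivative f (at x) v) (g x))"
      using Suc.prems ck_on_SucD[OF Suc.prems(1)] ck_on_SucD[OF Suc.prems(2)]
      by (intro ck_on_add[OF assms(2)] Suc.IH) simp_all
    then show ?thesis
      by (subst ck_on_cong[OF assms(2)]) (simp_all add: frechet_derivative_at[OF d, symmetric])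
  qed
  then show ?case using d by (auto simp: differentiable_def)
qed

text \<open>The derivative contains the inverse of \<open>f\<close> itself, but at one order less,
  so induction on \<open>k\<close> with \<open>f\<close> fixed closes.\<close>

lemma ck_on_inverse:
  fixes f :: "'a::euclidean_space \<Rightarrow> 'b::real_normed_field"
  assumes "open U" "\<And>x. x \<in> U \<Longrightarrow> f x \<noteq> 0"
  shows "ck_on k U f \<Longrightarrow> ck_on k U (\<lambda>x. inverse (f x))"
proof (induction k)
  case 0
  then show ?case using assms(2) by (auto intro: continuous_on_inverse)
next
  case (Suc k)
  have d: "((\<lambda>x. inverse (f x)) has_derivative
      (\<lambda>v. - (inverse (f x) * frechet_derivative f (at x) v * inverse (f x)))) (at x)"
    if "x \<in> U" for x
    using Suc.prems that assms(2)
    by (intro Deriv.has_derivative_inverse) (simp_all add: frechet_derivative_works)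
  have IH: "ck_on k U (\<lambda>x. inverse (f x))"
    using Suc.IH Suc.prems ck_on_SucD by blast
  have "ck_on k U (\<lambda>x. frechet_derivative (\<lambda>x. inverse (f x)) (at x) v)" for v
  proof -
    have "ck_on k U (\<lambda>x. - (inverse (f x) * frechet_derivative f (at x) v * inverse (f x)))"
      using Suc.prems IH
      by (intro ck_on_bounded_linear[OF bounded_linear_minus[OF bounded_linear_ident] assms(1)]
          ck_on_bilinear[OF bounded_bilinear_mult assms(1)]) simp_all
    then show ?thesis
      by (subst ck_on_cong[OF assms(1)]) (simp_all add: frechet_derivative_at[OF d, symmetric])
  qed
  then show ?case using d by (auto simp: differentiable_def)
qed

lemma ck_on_linear_id: "bounded_linear h \<Longrightarrow> open U \<Longrightarrow> ck_on k U h"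
proof -
  assume h: "bounded_linear h" "open U"
  have "ck_on k U (\<lambda>x. x)"
  proof (cases k)
    case (Suc j)
    then show ?thesis by (auto intro: ck_on_const)
  qed (auto intro: continuous_on_id)
  then show ?thesis using ck_on_bounded_linear[OF h] by blast
qed

section \<open>Real-analytic functions\<close>

definition multi_indices :: "('a::euclidean_space \<Rightarrow> nat) set" where
  "multi_indices = {\<alpha>. \<forall>b. b \<notin> Basis \<longrightarrow> \<alpha> b = 0}"

definition monomial :: "('a::euclidean_space \<Rightarrow> nat) \<Rightarrow> 'a \<Rightarrow> real" where
  "monomial \<alpha> y = (\<Prod>b\<in>Basis. (y \<bullet> b) ^ \<alpha> b)"

definition multi_degree :: "('a::euclidean_space \<Rightarrow> nat) \<Rightarrow> nat" where
  "multi_degree \<alpha> = (\<Sum>b\<in>Basis. \<alpha> b)"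

lemma real_analytic_on_iff:
  "real_analytic_on U f \<longleftrightarrow> (\<forall>p\<in>U. \<exists>r>0. \<exists>c. \<forall>x\<in>ball p r.
     ((\<lambda>\<alpha>. monomial \<alpha> (x - p) *\<^sub>R c \<alpha>) has_sum f x) multi_indices)"
  by (simp add: real_analytic_on_def monomial_def multi_indices_def)

text \<open>In finite dimension unconditional convergence is absolute: it is so for each real
  coordinate, and the norm is at most the sum of the absolute coordinates.\<close>

lemma has_sum_imp_abs_summable:
  fixes f :: "'i \<Rightarrow> 'b::euclidean_space"
  assumes "(f has_sum S) A"
  shows "(\<lambda>i. norm (f i)) summable_on A"
proof -
  have "(\<lambda>i. \<bar>f i \<bullet> b\<bar>) summable_on A" for b
  proof -
    have "(\<lambda>i. f i \<bullet> b) summable_on A"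
      using has_sum_bounded_linear[OF bounded_linear_inner_left assms] by (rule has_sum_imp_summable)
    from iffD1[OF summable_on_iff_abs_summable_on_real this] show ?thesis by simp
  qed
  note 1 = this
  have "(\<lambda>i. \<Sum>b\<in>B. \<bar>f i \<bullet> b\<bar>) summable_on A" if "finite B" for B
    using that by (induction rule: finite_induct) (auto intro: summable_on_add 1)
  from this[OF finite_Basis]
  have "(\<lambda>i. \<Sum>b\<in>Basis. \<bar>f i \<bullet> b\<bar>) summable_on A" .
  then show ?thesis
    by (rule Infinite_Sum.abs_summable_on_comparison_test') (rule norm_le_l1)
qed

lemma real_analytic_on_subset: "real_analytic_on U f \<Longrightarrow> V \<subseteq> U \<Longrightarrow> real_analytic_on V f"
  unfolding real_analytic_on_iff by blast

lemma real_analytic_on_cong: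
  assumes "open U" "\<And>x. x \<in> U \<Longrightarrow> f x = g x" "real_analytic_on U f"
  shows "real_analytic_on U g"
  unfolding real_analytic_on_iff
proof
  fix p assume p: "p \<in> U"
  then obtain r c where rc: "r > 0" "\<forall>x\<in>ball p r.
     ((\<lambda>\<alpha>. monomial \<alpha> (x - p) *\<^sub>R c \<alpha>) has_sum f x) multi_indices"
    using assms(3) unfolding real_analytic_on_iff by blast
  obtain e where e: "e > 0" "ball p e \<subseteq> U"
    using p assms(1) open_contains_ball by blast
  show "\<exists>r>0. \<exists>c. \<forall>x\<in>ball p r.
     ((\<lambda>\<alpha>. monomial \<alpha> (x - p) *\<^sub>R c \<alpha>) has_sum g x) multi_indices"
  proof (intro exI[of _ "min r e"] conjI exI[of _ c] ballI)
    fix x assume x: "x \<in> ball p (min r e)"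
    then have "x \<in> U" using e by auto
    with x bspec[OF rc(2), of x] assms(2)[of x]
    show "((\<lambda>\<alpha>. monomial \<alpha> (x - p) *\<^sub>R c \<alpha>) has_sum g x) multi_indices" by auto
  qed (use rc e in auto)
qed

lemma real_analytic_on_bounded_linear:
  assumes "bounded_linear h" "real_analytic_on U f"
  shows "real_analytic_on U (\<lambda>x. h (f x))"
  unfolding real_analytic_on_iff
proof
  interpret h: bounded_linear h by fact
  fix p assume p: "p \<in> U"
  then obtain r c where rc: "r > 0" "\<forall>x\<in>ball p r.
     ((\<lambda>\<alpha>. monomial \<alpha> (x - p) *\<^sub>R c \<alpha>) has_sum f x) multi_indices"
    using assms(2) unfolding real_analytic_on_iff by blast
  show "\<exists>r>0. \<exists>c. \<forall>x\<in>ball p r.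
     ((\<lambda>\<alpha>. monomial \<alpha> (x - p) *\<^sub>R c \<alpha>) has_sum h (f x)) multi_indices"
  proof (intro exI[of _ r] exI[of _ "\<lambda>\<alpha>. h (c \<alpha>)"] conjI rc(1) ballI)
    fix x assume "x \<in> ball p r"
    then show "((\<lambda>\<alpha>. monomial \<alpha> (x - p) *\<^sub>R h (c \<alpha>)) has_sum h (f x)) multi_indices"
      using has_sum_bounded_linear[OF assms(1), where f = "\<lambda>\<alpha>. monomial \<alpha> (x - p) *\<^sub>R c \<alpha>" and S = "f x"] rc(2)
      by (simp add: h.scaleR)
  qed
qed

lemma real_analytic_on_add:
  assumes "real_analytic_on U f" "real_analytic_on U g"
  shows "real_analytic_on U (\<lambda>x. f x + g x)"
  unfolding real_analytic_on_iff
proof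
  fix p assume p: "p \<in> U"
  then obtain r c where rc: "r > 0" "\<forall>x\<in>ball p r.
     ((\<lambda>\<alpha>. monomial \<alpha> (x - p) *\<^sub>R c \<alpha>) has_sum f x) multi_indices"
    using assms(1) unfolding real_analytic_on_iff by blast
  obtain s d where sd: "s > 0" "\<forall>x\<in>ball p s.
     ((\<lambda>\<alpha>. monomial \<alpha> (x - p) *\<^sub>R d \<alpha>) has_sum g x) multi_indices"
    using assms(2) p unfolding real_analytic_on_iff by blast
  show "\<exists>r>0. \<exists>c. \<forall>x\<in>ball p r.
     ((\<lambda>\<alpha>. monomial \<alpha> (x - p) *\<^sub>R c \<alpha>) has_sum f x + g x) multi_indices"
  proof (intro exI[of _ "min r s"] exI[of _ "\<lambda>\<alpha>. c \<alpha> + d \<alpha>"] conjI ballI)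
    fix x assume "x \<in> ball p (min r s)"
    then show "((\<lambda>\<alpha>. monomial \<alpha> (x - p) *\<^sub>R (c \<alpha> + d \<alpha>)) has_sum f x + g x) multi_indices"
      using rc(2) sd(2) by (auto simp: scaleR_add_right intro!: has_sum_add)
  qed (use rc sd in auto)
qed

lemma real_analytic_on_zero: "real_analytic_on U (\<lambda>x. 0)"
  unfolding real_analytic_on_iff by (auto intro!: exI[of _ 1] exI[of _ "\<lambda>_. 0"])

section \<open>Products of power series\<close>

lemma monomial_add: "monomial (\<lambda>b. \<alpha> b + \<beta> b) y = monomial \<alpha> y * monomial \<beta> y"
  by (simp add: monomial_def power_add prod.distrib)

text \<open>Both parts of a splitting are bounded by \<gamma> on the finite set \<open>Basis\<close>
  and vanish off it. Hence the coefficients of a Cauchy product are finite sums.\<close>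

lemma finite_multi_index_splittings:
  fixes \<gamma> :: "'a::euclidean_space \<Rightarrow> nat"
  assumes "\<gamma> \<in> multi_indices"
  shows "finite {(\<alpha>, \<beta>). \<alpha> \<in> multi_indices \<and> \<beta> \<in> multi_indices \<and> (\<lambda>b. \<alpha> b + \<beta> b) = \<gamma>}"
    (is "finite ?S")
proof -
  have fin: "finite {\<alpha>. \<alpha> \<in> multi_indices \<and> (\<forall>b. \<alpha> b \<le> \<gamma> b)}"
  proof (rule finite_subset)
    show "{\<alpha>. \<alpha> \<in> multi_indices \<and> (\<forall>b. \<alpha> b \<le> \<gamma> b)} \<subseteq>
      {\<alpha>. \<forall>b. (b \<in> Basis \<longrightarrow> \<alpha> b \<in> {..Max (\<gamma> ` Basis)}) \<and> (b \<notin> Basis \<longrightarrow> \<alpha> b = 0)}"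
      by (auto simp: multi_indices_def intro: order_trans Max_ge)
    show "finite {\<alpha>. \<forall>b. (b \<in> (Basis::'a set) \<longrightarrow> \<alpha> b \<in> {..Max (\<gamma> ` Basis)}) \<and> (b \<notin> Basis \<longrightarrow> \<alpha> b = (0::nat))}"
      by (rule finite_set_of_finite_funs) auto
  qed
  have "?S \<subseteq> {\<alpha>. \<alpha> \<in> multi_indices \<and> (\<forall>b. \<alpha> b \<le> \<gamma> b)} \<times> {\<alpha>. \<alpha> \<in> multi_indices \<and> (\<forall>b. \<alpha> b \<le> \<gamma> b)}"
    by auto
  with fin show ?thesis by (meson finite_SigmaI finite_subset)
qed

text \<open>Cauchy product: absolute convergence makes the double series summable over all pairs of
  multi-indices, so that it may be regrouped by the sum of the pair.\<close>

lemma real_analytic_on_scaleR: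
  fixes f :: "'a::euclidean_space \<Rightarrow> 'b::euclidean_space"
  assumes "real_analytic_on U g" "real_analytic_on U f"
  shows "real_analytic_on U (\<lambda>x. g x *\<^sub>R f x)"
  unfolding real_analytic_on_iff
proof
  fix p assume p: "p \<in> U"
  let ?I = "multi_indices :: ('a \<Rightarrow> nat) set"
  obtain r c where rc: "r > 0" "\<And>x. x \<in> ball p r \<Longrightarrow>
     ((\<lambda>\<alpha>. monomial \<alpha> (x - p) *\<^sub>R c \<alpha>) has_sum g x) ?I"
    using assms(1) p unfolding real_analytic_on_iff by blast
  obtain s d where sd: "s > 0" "\<And>x. x \<in> ball p s \<Longrightarrow>
     ((\<lambda>\<alpha>. monomial \<alpha> (x - p) *\<^sub>R d \<alpha>) has_sum f x) ?I"
    using assms(2) p unfolding real_analytic_on_iff by blast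
  define S where "S \<gamma> = {(\<alpha>, \<beta>). \<alpha> \<in> ?I \<and> \<beta> \<in> ?I \<and> (\<lambda>b. \<alpha> b + \<beta> b) = \<gamma>}" for \<gamma>
  define e where "e \<gamma> = (\<Sum>(\<alpha>, \<beta>)\<in>S \<gamma>. c \<alpha> *\<^sub>R d \<beta>)" for \<gamma>
  show "\<exists>r>0. \<exists>c. \<forall>x\<in>ball p r.
     ((\<lambda>\<alpha>. monomial \<alpha> (x - p) *\<^sub>R c \<alpha>) has_sum g x *\<^sub>R f x) ?I"
  proof (intro exI[of _ "min r s"] exI[of _ e] conjI ballI)
    fix x assume x: "x \<in> ball p (min r s)"
    define u where "u \<alpha> = monomial \<alpha> (x - p) *\<^sub>R c \<alpha>" for \<alpha>
    define w where "w \<alpha> = monomial \<alpha> (x - p) *\<^sub>R d \<alpha>" for \<alpha>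
    have u: "(u has_sum g x) ?I" and w: "(w has_sum f x) ?I"
      using x rc(2)[of x] sd(2)[of x] by (auto simp: u_def[abs_def] w_def[abs_def])
    have nu: "(\<lambda>\<alpha>. norm (u \<alpha>)) summable_on ?I" and nw: "(\<lambda>\<alpha>. norm (w \<alpha>)) summable_on ?I"
      using has_sum_imp_abs_summable[OF u] has_sum_imp_abs_summable[OF w] by auto
    have "(\<lambda>z. norm ((\<lambda>(\<alpha>, \<beta>). u \<alpha> *\<^sub>R w \<beta>) z)) summable_on (?I \<times> ?I)"
      unfolding Infinite_Sum.abs_summable_on_Sigma_iff[of "\<lambda>(\<alpha>, \<beta>). u \<alpha> *\<^sub>R w \<beta>"]
      using nu nw by (auto simp: infsum_cmult_right' abs_mult infsum_nonneg
          intro!: summable_on_cmult_right summable_on_cmult_left)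
    then have sm: "(\<lambda>(\<alpha>, \<beta>). u \<alpha> *\<^sub>R w \<beta>) summable_on (?I \<times> ?I)"
      by (rule Infinite_Sum.abs_summable_summable)
    have prod: "((\<lambda>(\<alpha>, \<beta>). u \<alpha> *\<^sub>R w \<beta>) has_sum g x *\<^sub>R f x) (?I \<times> ?I)"
    proof (rule has_sum_SigmaI[OF _ _ sm])
      show "((\<lambda>\<beta>. case (\<alpha>, \<beta>) of (\<alpha>, \<beta>) \<Rightarrow> u \<alpha> *\<^sub>R w \<beta>) has_sum u \<alpha> *\<^sub>R f x) ?I" for \<alpha>
        using has_sum_bounded_linear[OF bounded_linear_scaleR_right w] by simp
      show "((\<lambda>\<alpha>. u \<alpha> *\<^sub>R f x) has_sum g x *\<^sub>R f x) ?I"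
        by (rule has_sum_bounded_linear[OF bounded_linear_scaleR_left u])
    qed
    \<comment> \<open>Every pair lies over exactly one \<gamma>, namely its sum, so the fibres
      \<open>S \<gamma>\<close> partition the pairs.\<close>
    have "((\<lambda>(\<gamma>, \<alpha>, \<beta>). u \<alpha> *\<^sub>R w \<beta>) has_sum g x *\<^sub>R f x) (Sigma ?I S) \<longleftrightarrow>
        ((\<lambda>(\<alpha>, \<beta>). u \<alpha> *\<^sub>R w \<beta>) has_sum g x *\<^sub>R f x) (?I \<times> ?I)"
      by (rule has_sum_reindex_bij_witness[where i = "\<lambda>(\<alpha>, \<beta>). (\<lambda>b. \<alpha> b + \<beta> b, \<alpha>, \<beta>)" and j = snd])
        (auto simp: S_def multi_indices_def)
    with prod have "((\<lambda>(\<gamma>, \<alpha>, \<beta>). u \<alpha> *\<^sub>R w \<beta>) has_sum g x *\<^sub>R f x) (Sigma ?I S)"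
      by simp
    then show "((\<lambda>\<alpha>. monomial \<alpha> (x - p) *\<^sub>R e \<alpha>) has_sum g x *\<^sub>R f x) ?I"
    proof (rule has_sum_SigmaD)
      fix \<gamma> :: "'a \<Rightarrow> nat" assume "\<gamma> \<in> ?I"
      then have fin: "finite (S \<gamma>)" unfolding S_def by (rule finite_multi_index_splittings)
      have "monomial \<gamma> (x - p) *\<^sub>R e \<gamma> = (\<Sum>(\<alpha>, \<beta>)\<in>S \<gamma>. u \<alpha> *\<^sub>R w \<beta>)"
        by (auto simp: e_def scaleR_sum_right u_def w_def S_def monomial_add[symmetric]
            split_def mult_ac intro!: sum.cong)
      then show "((\<lambda>y. case (\<gamma>, y) of (\<gamma>, \<alpha>, \<beta>) \<Rightarrow> u \<alpha> *\<^sub>R w \<beta>) has_sum monomial \<gamma> (x - p) *\<^sub>R e \<gamma>) (S \<gamma>)"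
        using fin by (intro has_sum_finiteI) auto
    qed
  qed (use rc sd in auto)
qed

section \<open>Termwise differentiation of power series\<close>

text \<open>Remainder of the first-order Taylor formula. Passing from n to n + 1 multiplies the
  remainder by y + t and adds n t^2 y^(n-1), and n^2 + n \<le> (n + 1)^2. The factor R^2 stands on
  the left because a power with exponent n - 2 would fail for n < 2.\<close>

lemma power_second_difference_bound:
  fixes y t R :: real
  assumes "\<bar>y\<bar> + \<bar>t\<bar> \<le> R"
  shows "\<bar>(y + t) ^ n - y ^ n - real n * t * y ^ (n - 1)\<bar> * R\<^sup>2 \<le> t\<^sup>2 * (real n)\<^sup>2 * R ^ n"
proof (induction n)
  case (Suc n)
  define e where "e = (y + t) ^ n - y ^ n - real n * t * y ^ (n - 1)"
  have R: "R \<ge> 0" "\<bar>y\<bar> \<le> R" "\<bar>y + t\<bar> \<le> R" using assms by auto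
  have y: "real n * y * y ^ (n - 1) = real n * y ^ n" by (cases n) auto
  have "(y + t) ^ Suc n - y ^ Suc n - real (Suc n) * t * y ^ (Suc n - 1) =
      (y + t) * e + real n * t\<^sup>2 * y ^ (n - 1)"
    using y by (simp add: e_def algebra_simps power2_eq_square)
  moreover have "\<bar>(y + t) * e + real n * t\<^sup>2 * y ^ (n - 1)\<bar> \<le> \<bar>y + t\<bar> * \<bar>e\<bar> + real n * t\<^sup>2 * \<bar>y\<bar> ^ (n - 1)"
    by (rule order_trans[OF abs_triangle_ineq]) (simp add: abs_mult power_abs)
  ultimately have "\<bar>(y + t) ^ Suc n - y ^ Suc n - real (Suc n) * t * y ^ (Suc n - 1)\<bar> * R\<^sup>2 \<le>
      \<bar>y + t\<bar> * (\<bar>e\<bar> * R\<^sup>2) + real n * t\<^sup>2 * (\<bar>y\<bar> ^ (n - 1) * R\<^sup>2)"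
    by (metis (no_types) distrib_right mult.assoc mult_right_mono zero_le_power2)
  also have "\<dots> \<le> R * (t\<^sup>2 * (real n)\<^sup>2 * R ^ n) + real n * t\<^sup>2 * (R * R ^ n)"
  proof (rule add_mono, rule mult_mono)
    show "\<bar>e\<bar> * R\<^sup>2 \<le> t\<^sup>2 * (real n)\<^sup>2 * R ^ n" using Suc by (simp add: e_def)
    show "real n * t\<^sup>2 * (\<bar>y\<bar> ^ (n - 1) * R\<^sup>2) \<le> real n * t\<^sup>2 * (R * R ^ n)"
    proof (cases n)
      case (Suc m)
      have "\<bar>y\<bar> ^ m * R\<^sup>2 \<le> R ^ m * R\<^sup>2"
        using R by (intro mult_right_mono power_mono) auto
      then have "\<bar>y\<bar> ^ (n - 1) * R\<^sup>2 \<le> R * R ^ n"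
        using Suc by (simp add: power2_eq_square mult.left_commute mult.commute)
      then show ?thesis by (rule mult_left_mono) simp
    qed simp
  qed (use R in auto)
  also have "\<dots> = t\<^sup>2 * R ^ Suc n * ((real n)\<^sup>2 + real n)"
    by (simp add: algebra_simps)
  also have "\<dots> \<le> t\<^sup>2 * R ^ Suc n * (real (Suc n))\<^sup>2"
  proof (rule mult_left_mono)
    show "(real n)\<^sup>2 + real n \<le> (real (Suc n))\<^sup>2" by (simp add: power2_eq_square algebra_simps)
    show "0 \<le> t\<^sup>2 * R ^ Suc n" using R by (intro mult_nonneg_nonneg[OF zero_le_power2] zero_le_power)
  qed
  finally show ?case by (simp add: mult_ac)
qed simp

text \<open>Halving the radius pays for the factor n^2 of the remainder bound. The inductive step
  needs 2 n + 1 \<le> n^2, which holds from n = 3 on; smaller n are checked directly.\<close>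

lemma square_le_power_two: "(real n)\<^sup>2 \<le> 4 * 2 ^ n"
proof (induction n)
  case (Suc n)
  show ?case
  proof (cases "n \<le> 2")
    case True
    then consider "n = 0" | "n = 1" | "n = 2" by linarith
    then show ?thesis by cases auto
  next
    case False
    then have "real n \<ge> 3" by simp
    then have "2 * real n + 1 \<le> real n * real n"
      using mult_right_mono[of 3 "real n" "real n"] by linarith
    then have "(real (Suc n))\<^sup>2 \<le> 2 * (real n)\<^sup>2"
      by (simp add: power2_eq_square algebra_simps)
    with Suc show ?thesis by simp
  qed
qed simp


lemma monomial_update:
  assumes "b \<in> Basis"
  shows "monomial \<alpha> y = (\<Prod>b'\<in>Basis - {b}. (y \<bullet> b') ^ \<alpha> b') * (y \<bullet> b) ^ \<alpha> b"
  unfolding monomial_def by (subst prod.remove[OF finite_Basis assms]) (simp add: mult.commute)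

lemma multi_degree_update:
  assumes "b \<in> Basis"
  shows "multi_degree \<alpha> = (\<Sum>b'\<in>Basis - {b}. \<alpha> b') + \<alpha> b"
  unfolding multi_degree_def by (subst sum.remove[OF finite_Basis assms]) simp

text \<open>Absolute convergence at the corner \<open>p + s *\<^sub>R One\<close> of a cube dominates all series below.\<close>

lemma real_analytic_on_dominated:
  fixes f :: "'a::euclidean_space \<Rightarrow> 'b::euclidean_space"
  assumes "real_analytic_on U f" "p \<in> U"
  obtains s c where "s > 0" "(\<lambda>\<alpha>. norm (c \<alpha>) * s ^ multi_degree \<alpha>) summable_on multi_indices"
    "\<And>x. x \<in> ball p s \<Longrightarrow> ((\<lambda>\<alpha>. monomial \<alpha> (x - p) *\<^sub>R c \<alpha>) has_sum f x) multi_indices"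
proof -
  obtain r c where rc: "r > 0" "\<And>x. x \<in> ball p r \<Longrightarrow>
     ((\<lambda>\<alpha>. monomial \<alpha> (x - p) *\<^sub>R c \<alpha>) has_sum f x) multi_indices"
    using assms unfolding real_analytic_on_iff by blast
  \<comment> \<open>The corner has norm at most s DIM('a) = r / 2, so it lies inside the ball of
    convergence.\<close>
  define s where "s = r / (2 * real DIM('a))"
  have s: "s > 0" using rc by (simp add: s_def)
  have "norm (s *\<^sub>R (One :: 'a)) \<le> s * real DIM('a)"
    using norm_le_l1[of "s *\<^sub>R (One :: 'a)"] s by (simp add: mult_ac)
  also have "\<dots> < r" using rc by (simp add: s_def)
  finally have "p + s *\<^sub>R One \<in> ball p r" by (simp add: dist_norm)
  from has_sum_imp_abs_summable[OF rc(2)[OF this]]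
  have sm: "(\<lambda>\<alpha>. norm (c \<alpha>) * s ^ multi_degree \<alpha>) summable_on multi_indices"
    using s by (simp add: monomial_def multi_degree_def power_sum[symmetric] prod_nonneg abs_prod mult.commute)
  define D where "D = real DIM('a)"
  have "1 \<le> D" by (simp add: D_def)
  then have "r / (2 * D) \<le> r / 1"
    using rc(1) by (intro divide_left_mono) auto
  then have "s \<le> r" by (simp add: s_def D_def)
  then show thesis
    using that[OF s sm] rc(2) by auto
qed

text \<open>Only the factor of the coordinate \<open>b\<close> moves; the others are at most powers
  of s. For the moving factor R = s / 2 is admissible, and n^2 (s / 2)^n \<le> 4 s^n divided by (s /
  2)^2 gives the constant 16 / s^2. The truncated exponent at \<alpha> b = 0 is harmless, as its
  coefficient is 0.\<close>

lemma monomial_second_difference_bound: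
  fixes y :: "'a::euclidean_space"
  assumes s: "s > 0" and b: "b \<in> Basis" and y: "norm y \<le> s / 4" and t: "\<bar>t\<bar> \<le> s / 4"
  shows "\<bar>monomial \<alpha> (y + t *\<^sub>R b) - monomial \<alpha> y -
      t * (real (\<alpha> b) * monomial (\<alpha>(b := \<alpha> b - 1)) y)\<bar> \<le> t\<^sup>2 * (16 / s\<^sup>2) * s ^ multi_degree \<alpha>"
proof -
  define P where "P = (\<Prod>b'\<in>Basis - {b}. (y \<bullet> b') ^ \<alpha> b')"
  define m where "m = (\<Sum>b'\<in>Basis - {b}. \<alpha> b')"
  define n where "n = \<alpha> b"
  define d where "d = (y \<bullet> b + t) ^ n - (y \<bullet> b) ^ n - real n * t * (y \<bullet> b) ^ (n - 1)"
  have 1: "monomial \<alpha> (y + t *\<^sub>R b) = P * (y \<bullet> b + t) ^ n"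
    using b unfolding monomial_update[OF b] P_def n_def
    by (auto simp: inner_add_left inner_Basis intro!: arg_cong2[of _ _ _ _ "(*)"] prod.cong)
  have 2: "monomial \<alpha> y = P * (y \<bullet> b) ^ n"
    unfolding monomial_update[OF b] P_def n_def ..
  have 3: "monomial (\<alpha>(b := \<alpha> b - 1)) y = P * (y \<bullet> b) ^ (n - 1)"
    unfolding monomial_update[OF b] P_def n_def by simp
  have yb: "\<bar>y \<bullet> b'\<bar> \<le> s / 4" if "b' \<in> Basis" for b'
    using Basis_le_norm[OF that, of y] y by linarith
  have "\<bar>P\<bar> \<le> (\<Prod>b'\<in>Basis - {b}. s ^ \<alpha> b')"
    unfolding P_def abs_prod power_abs
  proof (intro prod_mono conjI power_mono)
    show "\<bar>y \<bullet> b'\<bar> \<le> s" if "b' \<in> Basis - {b}" for b'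
      using yb[of b'] that s by simp
  qed auto
  then have P: "\<bar>P\<bar> \<le> s ^ m" by (simp add: m_def power_sum)
  have "\<bar>d\<bar> * (s / 2)\<^sup>2 \<le> t\<^sup>2 * (real n)\<^sup>2 * (s / 2) ^ n"
    unfolding d_def using yb[OF b] t by (intro power_second_difference_bound) linarith
  also have "\<dots> \<le> t\<^sup>2 * (4 * 2 ^ n) * (s / 2) ^ n"
    using s by (intro mult_right_mono mult_left_mono square_le_power_two) auto
  also have "\<dots> = t\<^sup>2 * 4 * s ^ n" by (simp add: power_divide)
  finally have d: "\<bar>d\<bar> \<le> t\<^sup>2 * (16 / s\<^sup>2) * s ^ n"
    using s by (simp add: field_simps)
  have "\<bar>P * d\<bar> \<le> s ^ m * (t\<^sup>2 * (16 / s\<^sup>2) * s ^ n)"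
    unfolding abs_mult using s by (intro mult_mono P d) auto
  also have "\<dots> = t\<^sup>2 * (16 / s\<^sup>2) * s ^ multi_degree \<alpha>"
    by (simp add: multi_degree_update[OF b] m_def n_def power_add)
  finally show ?thesis
    unfolding 1 2 3 d_def by (simp add: n_def algebra_simps)
qed

text \<open>The exponent k + 1 produced by differentiation is at most 4 * 4^k, which the bound (s /
  4)^k on the coordinate absorbs; the lost power of s accounts for the factor 4 / s.\<close>

lemma monomial_derivative_bound:
  fixes y :: "'a::euclidean_space"
  assumes s: "s > 0" and b: "b \<in> Basis" and y: "norm y \<le> s / 4"
  shows "\<bar>real (\<alpha> b) * monomial (\<alpha>(b := \<alpha> b - 1)) y\<bar> \<le> (4 / s) * s ^ multi_degree \<alpha>"
proof -
  define P where "P = (\<Prod>b'\<in>Basis - {b}. (y \<bullet> b') ^ \<alpha> b')"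
  define m where "m = (\<Sum>b'\<in>Basis - {b}. \<alpha> b')"
  have 3: "monomial (\<alpha>(b := \<alpha> b - 1)) y = P * (y \<bullet> b) ^ (\<alpha> b - 1)"
    unfolding monomial_update[OF b] P_def by simp
  have yb: "\<bar>y \<bullet> b'\<bar> \<le> s / 4" if "b' \<in> Basis" for b'
    using Basis_le_norm[OF that, of y] y by linarith
  have "\<bar>P\<bar> \<le> (\<Prod>b'\<in>Basis - {b}. s ^ \<alpha> b')"
    unfolding P_def abs_prod power_abs
  proof (intro prod_mono conjI power_mono)
    show "\<bar>y \<bullet> b'\<bar> \<le> s" if "b' \<in> Basis - {b}" for b'
      using yb[of b'] that s by simp
  qed auto
  then have P: "\<bar>P\<bar> \<le> s ^ m" by (simp add: m_def power_sum)
  have d: "\<bar>real (\<alpha> b) * (y \<bullet> b) ^ (\<alpha> b - 1)\<bar> \<le> (4 / s) * s ^ \<alpha> b"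
  proof (cases "\<alpha> b")
    case (Suc k)
    have "\<bar>y \<bullet> b\<bar> ^ k \<le> (s / 4) ^ k"
      using yb[OF b] by (intro power_mono) auto
    moreover have "real (Suc k) \<le> 4 * 4 ^ k"
      by (induction k) auto
    ultimately have "real (Suc k) * \<bar>y \<bullet> b\<bar> ^ k \<le> (4 * 4 ^ k) * (s / 4) ^ k"
      by (intro mult_mono) auto
    then show ?thesis using Suc s by (simp add: abs_mult power_abs power_divide)
  qed (use s in simp)
  have "\<bar>P * (real (\<alpha> b) * (y \<bullet> b) ^ (\<alpha> b - 1))\<bar> \<le> s ^ m * ((4 / s) * s ^ \<alpha> b)"
    unfolding abs_mult[of P] using s by (intro mult_mono P d) auto
  also have "\<dots> = (4 / s) * s ^ multi_degree \<alpha>"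
    by (simp add: multi_degree_update[OF b] m_def power_add)
  finally show ?thesis unfolding 3 by (simp add: mult_ac)
qed

text \<open>The termwise derivative converges to some \<open>g\<close> by domination, and the
  remainder estimate, summed over all multi-indices, shows that the difference quotients along
  \<open>b\<close> tend to \<open>g\<close>. Since \<open>f\<close> is assumed differentiable,
  uniqueness identifies \<open>g\<close> with the Frechet derivative.\<close>

lemma real_analytic_on_Basis_derivative:
  fixes f :: "'a::euclidean_space \<Rightarrow> 'b::euclidean_space"
  assumes an: "real_analytic_on U f" and b: "b \<in> Basis" and "open U"
    and diff: "\<And>x. x \<in> U \<Longrightarrow> f differentiable (at x)"
  shows "real_analytic_on U (\<lambda>x. frechet_derivative f (at x) b)"
  unfolding real_analytic_on_iff
proof
  fix p assume p: "p \<in> U"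
  let ?I = "multi_indices :: ('a \<Rightarrow> nat) set"
  obtain s0 c where s0: "s0 > 0" "(\<lambda>\<alpha>. norm (c \<alpha>) * s0 ^ multi_degree \<alpha>) summable_on ?I"
    "\<And>x. x \<in> ball p s0 \<Longrightarrow> ((\<lambda>\<alpha>. monomial \<alpha> (x - p) *\<^sub>R c \<alpha>) has_sum f x) ?I"
    using real_analytic_on_dominated[OF an p] by blast
  obtain r where r: "r > 0" "ball p r \<subseteq> U"
    using p \<open>open U\<close> open_contains_ball by blast
  define s where "s = min s0 r"
  have s: "s > 0" "s \<le> s0" "ball p s \<subseteq> U" using s0 r by (auto simp: s_def)
  have sm: "(\<lambda>\<alpha>. norm (c \<alpha>) * s ^ multi_degree \<alpha>) summable_on ?I"
    using s by (intro summable_on_comparison_test[OF s0(2)] mult_left_mono power_mono) auto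
  have fx: "((\<lambda>\<alpha>. monomial \<alpha> (x - p) *\<^sub>R c \<alpha>) has_sum f x) ?I" if "x \<in> ball p s" for x
    using s0(3) s that by auto
  define C where "C = infsum (\<lambda>\<alpha>. norm (c \<alpha>) * s ^ multi_degree \<alpha>) ?I"
  have C: "((\<lambda>\<alpha>. norm (c \<alpha>) * s ^ multi_degree \<alpha>) has_sum C) ?I"
    unfolding C_def using sm by (rule has_sum_infsum)
  \<comment> \<open>Coefficients of the differentiated series after the shift of the index in
    direction \<open>b\<close>.\<close>
  define c' where "c' \<beta> = real (\<beta> b + 1) *\<^sub>R c (\<beta>(b := \<beta> b + 1))" for \<beta>
  show "\<exists>r>0. \<exists>c. \<forall>x\<in>ball p r.
     ((\<lambda>\<alpha>. monomial \<alpha> (x - p) *\<^sub>R c \<alpha>) has_sum frechet_derivative f (at x) b) ?I"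
  \<comment> \<open>With |x - p| and |t| at most s / 4 the monomial bounds apply, and x + t b stays
    in the ball of radius s.\<close>
  proof (intro exI[of _ "s / 4"] exI[of _ c'] conjI ballI)
    fix x assume x: "x \<in> ball p (s / 4)"
    define y where "y = x - p"
    have y: "norm y \<le> s / 4" using x by (simp add: y_def dist_norm norm_minus_commute)
    define u where "u \<alpha> = (real (\<alpha> b) * monomial (\<alpha>(b := \<alpha> b - 1)) y) *\<^sub>R c \<alpha>" for \<alpha>
    have nu: "norm (u \<alpha>) \<le> (4 / s) * (norm (c \<alpha>) * s ^ multi_degree \<alpha>)" for \<alpha>
      using mult_right_mono[OF monomial_derivative_bound[OF s(1) b y, of \<alpha>], of "norm (c \<alpha>)"]
      by (simp add: u_def mult_ac)
    have "(\<lambda>\<alpha>. norm (u \<alpha>)) summable_on ?I"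
      by (rule Infinite_Sum.abs_summable_on_comparison_test'[OF summable_on_cmult_right[OF sm, of "4 / s"] nu])
    then have "u summable_on ?I" by (rule Infinite_Sum.abs_summable_summable)
    then obtain g where g: "(u has_sum g) ?I" by (auto simp: summable_on_def)
    \<comment> \<open>The error is quadratic in t, with a constant uniform in t: the remainders of
      the monomials are dominated by the series summing to \<open>C\<close>.\<close>
    have est: "norm (f (x + t *\<^sub>R b) - f x - t *\<^sub>R g) \<le> t\<^sup>2 * (16 / s\<^sup>2) * C" if t: "\<bar>t\<bar> \<le> s / 4" for t
    proof -
      have "dist p (x + t *\<^sub>R b) \<le> dist p x + norm (t *\<^sub>R b)"
        by (metis add_diff_cancel_left' dist_commute dist_norm dist_triangle)
      also have "\<dots> < s" using x t b s(1) by simp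
      finally have "((\<lambda>\<alpha>. monomial \<alpha> (y + t *\<^sub>R b) *\<^sub>R c \<alpha>) has_sum f (x + t *\<^sub>R b)) ?I"
        using fx[of "x + t *\<^sub>R b"] by (simp add: y_def algebra_simps)
      moreover have "((\<lambda>\<alpha>. monomial \<alpha> y *\<^sub>R c \<alpha>) has_sum f x) ?I"
        using fx[of x] x s(1) by (simp add: y_def)
      ultimately have "((\<lambda>\<alpha>. monomial \<alpha> (y + t *\<^sub>R b) *\<^sub>R c \<alpha> + - (monomial \<alpha> y *\<^sub>R c \<alpha>) + - (t *\<^sub>R u \<alpha>)) has_sum
          f (x + t *\<^sub>R b) + - f x + - (t *\<^sub>R g)) ?I"
        using has_sum_bounded_linear[OF bounded_linear_scaleR_right g]
        by (intro has_sum_add) (simp_all add: has_sum_uminus)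
      then have hs: "((\<lambda>\<alpha>. (monomial \<alpha> (y + t *\<^sub>R b) - monomial \<alpha> y -
          t * (real (\<alpha> b) * monomial (\<alpha>(b := \<alpha> b - 1)) y)) *\<^sub>R c \<alpha>) has_sum
          f (x + t *\<^sub>R b) - f x - t *\<^sub>R g) ?I"
        by (simp add: u_def algebra_simps)
      have bd: "((\<lambda>\<alpha>. (t\<^sup>2 * (16 / s\<^sup>2)) * (norm (c \<alpha>) * s ^ multi_degree \<alpha>)) has_sum
          t\<^sup>2 * (16 / s\<^sup>2) * C) ?I"
        using has_sum_cmult_right[OF C] by blast
      have "((\<lambda>\<alpha>. norm ((monomial \<alpha> (y + t *\<^sub>R b) - monomial \<alpha> y -
          t * (real (\<alpha> b) * monomial (\<alpha>(b := \<alpha> b - 1)) y)) *\<^sub>R c \<alpha>)) summable_on ?I)"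
        by (rule has_sum_imp_abs_summable[OF hs])
      then obtain N where N: "((\<lambda>\<alpha>. norm ((monomial \<alpha> (y + t *\<^sub>R b) - monomial \<alpha> y -
          t * (real (\<alpha> b) * monomial (\<alpha>(b := \<alpha> b - 1)) y)) *\<^sub>R c \<alpha>)) has_sum N) ?I"
        by (auto simp: summable_on_def)
      have "norm (f (x + t *\<^sub>R b) - f x - t *\<^sub>R g) \<le> N"
        by (rule norm_has_sum_bound[OF N hs])
      also have "N \<le> t\<^sup>2 * (16 / s\<^sup>2) * C"
      proof (rule has_sum_mono[OF N bd])
        fix \<alpha>
        show "norm ((monomial \<alpha> (y + t *\<^sub>R b) - monomial \<alpha> y -
          t * (real (\<alpha> b) * monomial (\<alpha>(b := \<alpha> b - 1)) y)) *\<^sub>R c \<alpha>) \<le>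
          t\<^sup>2 * (16 / s\<^sup>2) * (norm (c \<alpha>) * s ^ multi_degree \<alpha>)"
          using mult_right_mono[OF monomial_second_difference_bound[OF s(1) b y t, of \<alpha>], of "norm (c \<alpha>)"]
          by (simp add: mult_ac)
      qed
      finally show ?thesis .
    qed
    have "((\<lambda>t. f (x + t *\<^sub>R b)) has_vector_derivative g) (at 0)"
      unfolding has_vector_derivative_def has_derivative_at
    proof (intro conjI)
      show "bounded_linear (\<lambda>t. t *\<^sub>R g)" by (rule bounded_linear_scaleR_left)
      have "(\<lambda>h. norm (f (x + (0 + h) *\<^sub>R b) - f (x + 0 *\<^sub>R b) - h *\<^sub>R g) / norm h) \<midarrow>0\<rightarrow> 0"
      proof (rule Lim_null_comparison)
        show "\<forall>\<^sub>F h in at 0. norm (norm (f (x + (0 + h) *\<^sub>R b) - f (x + 0 *\<^sub>R b) - h *\<^sub>R g) / norm h) \<le>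
            \<bar>h\<bar> * ((16 / s\<^sup>2) * C)"
        proof (rule eventually_at[THEN iffD2], intro exI[of _ "s / 4"] conjI ballI impI)
          fix h :: real assume h: "h \<noteq> 0 \<and> dist h 0 < s / 4"
          then show "norm (norm (f (x + (0 + h) *\<^sub>R b) - f (x + 0 *\<^sub>R b) - h *\<^sub>R g) / norm h) \<le>
            \<bar>h\<bar> * ((16 / s\<^sup>2) * C)"
          proof -
            have "norm (f (x + h *\<^sub>R b) - f x - h *\<^sub>R g) \<le> \<bar>h\<bar> * ((16 / s\<^sup>2) * C) * \<bar>h\<bar>"
              using est[of h] h by (simp add: power2_eq_square mult_ac abs_mult_self_eq[symmetric, of h] del: abs_mult_self_eq)
            then show ?thesis using h by (simp add: pos_divide_le_eq)
          qed
        qed (use s in simp)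
        have "((\<lambda>h. \<bar>h\<bar> * ((16 / s\<^sup>2) * C)) \<longlongrightarrow> \<bar>0\<bar> * ((16 / s\<^sup>2) * C)) (at (0::real))"
          by (intro tendsto_intros)
        then show "(\<lambda>h. \<bar>h\<bar> * ((16 / s\<^sup>2) * C)) \<midarrow>0\<rightarrow> 0" by simp
      qed
      then show "(\<lambda>h. norm (f (x + (0 + h) *\<^sub>R b) - f (x + 0 *\<^sub>R b) - h *\<^sub>R g) / norm h) \<midarrow>0\<rightarrow> 0" .
    qed
    moreover have "((\<lambda>t. f (x + t *\<^sub>R b)) has_vector_derivative frechet_derivative f (at x) b) (at 0)"
    proof -
      have "x \<in> U" using x s by auto
      then have "(f has_derivative frechet_derivative f (at x)) (at (x + 0 *\<^sub>R b))"
        using diff frechet_derivative_works by auto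
      moreover have "((\<lambda>t. x + t *\<^sub>R b) has_derivative (\<lambda>t. t *\<^sub>R b)) (at 0)"
        by (auto intro!: derivative_eq_intros)
      ultimately have "((\<lambda>t. f (x + t *\<^sub>R b)) has_derivative (\<lambda>t. frechet_derivative f (at x) (t *\<^sub>R b))) (at 0)"
        using diff_chain_at[of "\<lambda>t. x + t *\<^sub>R b" "\<lambda>t. t *\<^sub>R b" 0 f] by (simp add: o_def)
      then show ?thesis
        using linear_frechet_derivative[OF diff[OF \<open>x \<in> U\<close>]]
        by (simp add: has_vector_derivative_def linear_cmul)
    qed
    ultimately have "g = frechet_derivative f (at x) b"
      by (rule vector_derivative_unique_at)
    moreover have "((\<lambda>\<beta>. monomial \<beta> y *\<^sub>R c' \<beta>) has_sum g) ?I"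
    proof -
      \<comment> \<open>Terms with \<alpha> b = 0 vanish, and the remaining indices are exactly the
        image of the shift, so the truncated subtraction is a true inverse there.\<close>
      have "(u has_sum g) {\<alpha> \<in> ?I. \<alpha> b \<noteq> 0}"
        using g by (subst has_sum_cong_neutral[where S = ?I and f = u, symmetric]) (auto simp: u_def)
      moreover have "((\<lambda>\<beta>. monomial \<beta> y *\<^sub>R c' \<beta>) has_sum g) ?I \<longleftrightarrow> (u has_sum g) {\<alpha> \<in> ?I. \<alpha> b \<noteq> 0}"
        by (rule has_sum_reindex_bij_witness[where i = "\<lambda>\<alpha>. \<alpha>(b := \<alpha> b - 1)" and j = "\<lambda>\<beta>. \<beta>(b := \<beta> b + 1)"])
          (use b in \<open>auto simp: multi_indices_def u_def c'_def\<close>)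
      ultimately show ?thesis by simp
    qed
    ultimately show "((\<lambda>\<alpha>. monomial \<alpha> (x - p) *\<^sub>R c' \<alpha>) has_sum frechet_derivative f (at x) b) ?I"
      by (simp add: y_def)
  qed (use s in simp)
qed

section \<open>Differentiability classes and second derivatives\<close>

text \<open>Guards against the truncated subtraction in \<open>drop_class\<close>: only for j \<le>
  k does the class \<open>Ck (k - j)\<close> account for j lost derivatives.\<close>

fun order_at_least :: "nat \<Rightarrow> smoothness \<Rightarrow> bool" where
  "order_at_least j (Ck k) \<longleftrightarrow> j \<le> k"
| "order_at_least j Cinf \<longleftrightarrow> True"
| "order_at_least j Comega \<longleftrightarrow> True"

lemma order_at_least_drop_class: "order_at_least (i + j) \<kappa> \<Longrightarrow> order_at_least i (drop_class \<kappa> j)"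
  by (cases \<kappa>) auto

lemma drop_class_drop_class: "drop_class (drop_class \<kappa> i) j = drop_class \<kappa> (i + j)"
  by (cases \<kappa>) auto

lemma class_on_imp_ck_on: "class_on \<kappa> U f \<Longrightarrow> order_at_least j \<kappa> \<Longrightarrow> ck_on j U f"
  by (cases \<kappa>) (auto simp: class_on_def intro: ck_on_le)

lemma class_on_open_subset: "class_on \<kappa> U f \<Longrightarrow> V \<subseteq> U \<Longrightarrow> class_on \<kappa> V f"
  by (auto simp: class_on_def intro: ck_on_subset real_analytic_on_subset split: smoothness.splits)

lemma class_on_drop_mono: "class_on (drop_class \<kappa> i) U f \<Longrightarrow> i \<le> j \<Longrightarrow> class_on (drop_class \<kappa> j) U f"
  by (cases \<kappa>) (auto simp: class_on_def intro: ck_on_le[rotated])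

lemma class_on_cong:
  assumes "open U" "\<And>x. x \<in> U \<Longrightarrow> f x = g x" "class_on \<kappa> U f"
  shows "class_on \<kappa> U g"
  using assms(3) ck_on_cong[OF assms(1,2)] real_analytic_on_cong[OF assms(1,2)]
  by (auto simp: class_on_def split: smoothness.splits)

lemma class_on_bounded_linear:
  "bounded_linear h \<Longrightarrow> open U \<Longrightarrow> class_on \<kappa> U f \<Longrightarrow> class_on \<kappa> U (\<lambda>x. h (f x))"
  by (auto simp: class_on_def intro: ck_on_bounded_linear real_analytic_on_bounded_linear
      split: smoothness.splits)

lemma class_on_add:
  "open U \<Longrightarrow> class_on \<kappa> U f \<Longrightarrow> class_on \<kappa> U g \<Longrightarrow> class_on \<kappa> U (\<lambda>x. f x + g x)"
  by (auto simp: class_on_def intro: ck_on_add real_analytic_on_add split: smoothness.splits)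

lemma class_on_scaleR:
  fixes f :: "'a::euclidean_space \<Rightarrow> 'b::euclidean_space"
  shows "open U \<Longrightarrow> class_on \<kappa> U g \<Longrightarrow> class_on \<kappa> U f \<Longrightarrow> class_on \<kappa> U (\<lambda>x. g x *\<^sub>R f x)"
  by (auto simp: class_on_def intro: ck_on_bilinear[OF bounded_bilinear_scaleR]
      real_analytic_on_scaleR split: smoothness.splits)

lemma class_on_zero: "class_on \<kappa> U (\<lambda>x. 0)"
  by (auto simp: class_on_def intro: ck_on_const real_analytic_on_zero split: smoothness.splits)

lemma class_on_sum:
  assumes "open U" "finite A" "\<And>i. i \<in> A \<Longrightarrow> class_on \<kappa> U (f i)"
  shows "class_on \<kappa> U (\<lambda>x. \<Sum>i\<in>A. f i x)"
  using assms(2,3)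
  by (induction A rule: finite_induct) (auto intro: class_on_zero class_on_add[OF assms(1)])

lemma ck_on_differentiable: "ck_on (Suc k) U f \<Longrightarrow> x \<in> U \<Longrightarrow> f differentiable (at x)"
  by simp

lemma frechet_derivative_Basis_sum:
  fixes f :: "'a::euclidean_space \<Rightarrow> 'b::real_normed_vector"
  assumes "f differentiable (at x)"
  shows "frechet_derivative f (at x) v = (\<Sum>b\<in>Basis. (v \<bullet> b) *\<^sub>R frechet_derivative f (at x) b)"
proof -
  note l = linear_frechet_derivative[OF assms]
  have "frechet_derivative f (at x) v = frechet_derivative f (at x) (\<Sum>b\<in>Basis. (v \<bullet> b) *\<^sub>R b)"
    by (simp add: euclidean_representation)
  also have "\<dots> = (\<Sum>b\<in>Basis. (v \<bullet> b) *\<^sub>R frechet_derivative f (at x) b)"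
    by (simp only: linear_sum[OF l] linear_cmul[OF l])
  finally show ?thesis .
qed

lemma class_on_Basis_derivative:
  fixes f :: "'a::euclidean_space \<Rightarrow> 'b::euclidean_space"
  assumes "open U" "class_on \<kappa> U f" "order_at_least 1 \<kappa>" "b \<in> Basis"
  shows "class_on (drop_class \<kappa> 1) U (\<lambda>x. frechet_derivative f (at x) b)"
proof (cases \<kappa>)
  case (Ck k)
  then show ?thesis using assms(2,3) by (cases k) (auto simp: class_on_def)
next
  case Cinf
  then have "ck_on (Suc k) U f" for k using assms(2) by (auto simp: class_on_def)
  with Cinf show ?thesis by (auto simp: class_on_def)
next
  case Comega
  then have "ck_on (Suc k) U f" for k using assms(2) by (auto simp: class_on_def)
  then have "ck_on k U (\<lambda>x. frechet_derivative f (at x) b)" for k by simp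
  with Comega assms show ?thesis
    using real_analytic_on_Basis_derivative[of U f b] ck_on_differentiable[of 0 U f]
    by (auto simp: class_on_def)
qed

text \<open>\<open>class_on\<close> speaks of derivatives in fixed directions only. Expanding the
  moving direction in \<open>Basis\<close> leaves finitely many such derivatives with scalar
  coefficients.\<close>

lemma class_on_derivative_along:
  fixes f :: "'a::euclidean_space \<Rightarrow> 'b::euclidean_space"
  assumes U: "open U" and f: "class_on \<kappa> U f" "order_at_least 1 \<kappa>"
    and g: "class_on (drop_class \<kappa> 1) U g"
  shows "class_on (drop_class \<kappa> 1) U (\<lambda>x. frechet_derivative f (at x) (g x))"
proof (rule class_on_cong[OF U])
  show "class_on (drop_class \<kappa> 1) U (\<lambda>x. \<Sum>b\<in>Basis. (g x \<bullet> b) *\<^sub>R frechet_derivative f (at x) b)"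
    by (intro class_on_sum class_on_scaleR class_on_Basis_derivative U f finite_Basis
        class_on_bounded_linear[OF bounded_linear_inner_left _ g])
  show "(\<Sum>b\<in>Basis. (g x \<bullet> b) *\<^sub>R frechet_derivative f (at x) b) = frechet_derivative f (at x) (g x)"
    if "x \<in> U" for x
    using frechet_derivative_Basis_sum[of f x "g x"] class_on_imp_ck_on[OF f] that by simp
qed

text \<open>Product rule for the pairing of df with a moving vector; this is where the second
  derivative of a chart enters when a field is pushed forward and differentiated.\<close>

lemma has_derivative_frechet_derivative_along:
  fixes f :: "'a::euclidean_space \<Rightarrow> 'b::real_normed_vector"
  assumes U: "open U" "x \<in> U" and f: "ck_on 2 U f" and g: "(g has_derivative g') (at x)"
  shows "((\<lambda>q. frechet_derivative f (at q) (g q)) has_derivative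
    (\<lambda>w. frechet_derivative f (at x) (g' w) +
      frechet_derivative (\<lambda>q. frechet_derivative f (at q) (g x)) (at x) w)) (at x)"
proof -
  have f: "ck_on (Suc (Suc 0)) U f" using f by (simp add: numeral_2_eq_2)
  have d: "f differentiable (at q)" if "q \<in> U" for q using f that by simp
  define S where "S v = frechet_derivative (\<lambda>q. frechet_derivative f (at q) v) (at x)" for v
  have S: "((\<lambda>q. frechet_derivative f (at q) v) has_derivative S v) (at x)" for v
    using f U by (simp add: S_def frechet_derivative_works[symmetric])
  have lin: "frechet_derivative f (at q) v = (\<Sum>b\<in>Basis. (v \<bullet> b) *\<^sub>R frechet_derivative f (at q) b)"
    if "q \<in> U" for q v
    using frechet_derivative_Basis_sum[OF d[OF that]] .
  \<comment> \<open>Linearity of the second derivative in the inner direction, obtained by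
    differentiating the basis expansion of df(v).\<close>
  have Slin: "S v w = (\<Sum>b\<in>Basis. (v \<bullet> b) *\<^sub>R S b w)" for v w
  proof -
    have "((\<lambda>q. \<Sum>b\<in>Basis. (v \<bullet> b) *\<^sub>R frechet_derivative f (at q) b) has_derivative
        (\<lambda>w. \<Sum>b\<in>Basis. (v \<bullet> b) *\<^sub>R S b w)) (at x)"
      by (intro has_derivative_sum has_derivative_scaleR_right S)
    then have "((\<lambda>q. frechet_derivative f (at q) v) has_derivative
        (\<lambda>w. \<Sum>b\<in>Basis. (v \<bullet> b) *\<^sub>R S b w)) (at x)"
      by (rule has_derivative_transform_within_open[OF _ U]) (simp add: lin[symmetric])
    from has_derivative_unique[OF S this] show ?thesis by metis
  qed
  have "((\<lambda>q. \<Sum>b\<in>Basis. (g q \<bullet> b) *\<^sub>R frechet_derivative f (at q) b) has_derivative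
      (\<lambda>w. \<Sum>b\<in>Basis. (g x \<bullet> b) *\<^sub>R S b w + (g' w \<bullet> b) *\<^sub>R frechet_derivative f (at x) b)) (at x)"
    by (intro has_derivative_sum has_derivative_scaleR S has_derivative_inner_left g)
  moreover have "(\<lambda>w. \<Sum>b\<in>Basis. (g x \<bullet> b) *\<^sub>R S b w + (g' w \<bullet> b) *\<^sub>R frechet_derivative f (at x) b) =
      (\<lambda>w. frechet_derivative f (at x) (g' w) + S (g x) w)"
    by (simp add: sum.distrib lin[OF U(2), symmetric] Slin[symmetric] add.commute)
  ultimately have "((\<lambda>q. \<Sum>b\<in>Basis. (g q \<bullet> b) *\<^sub>R frechet_derivative f (at q) b) has_derivative
      (\<lambda>w. frechet_derivative f (at x) (g' w) + S (g x) w)) (at x)" by simp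
  then show ?thesis unfolding S_def
    by (rule has_derivative_transform_within_open[OF _ U]) (simp add: lin[symmetric])
qed

section \<open>Symmetry of second derivatives\<close>

text \<open>The second difference of \<open>f\<close> along \<open>v\<close> and \<open>w\<close> is symmetric in \<open>v\<close> and \<open>w\<close>, and the mean value
  inequality compares it with the iterated derivative.\<close>

lemma second_difference_tendsto:
  fixes f :: "'a::euclidean_space \<Rightarrow> 'b::real_normed_vector"
  assumes U: "open U" "x \<in> U" and f: "ck_on 2 U f"
  shows "((\<lambda>t. (f (x + t *\<^sub>R v + t *\<^sub>R w) - f (x + t *\<^sub>R v) - f (x + t *\<^sub>R w) + f x) /\<^sub>R t\<^sup>2) \<longlongrightarrow>
    frechet_derivative (\<lambda>q. frechet_derivative f (at q) v) (at x) w) (at_right (0::real))"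
    (is "(?Q \<longlongrightarrow> _) _")
proof (rule tendstoI)
  fix e :: real assume e: "e > 0"
  have f: "ck_on (Suc (Suc 0)) U f" using f by (simp add: numeral_2_eq_2)
  define D where "D q = frechet_derivative f (at q) v" for q
  define A where "A = frechet_derivative D (at x)"
  have D: "(D has_derivative A) (at x)"
    unfolding A_def using f U by (simp add: frechet_derivative_works[symmetric] D_def[abs_def])
  then have linA: "linear A" by (rule has_derivative_linear)
  \<comment> \<open>\<open>t * m\<close> bounds every displacement s v + k w with s and k in [0, t];
    the summand 1 keeps \<open>m\<close> positive. The choice of \<open>e'\<close> makes the final
    bound 2 e' m equal to e / 2.\<close>
  define m where "m = 2 * norm v + norm w + 1"
  have m: "m > 0" unfolding m_def by (smt (verit) norm_ge_zero)
  define e' where "e' = e / (4 * m)"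
  have e': "e' > 0" using e m by (simp add: e'_def)
  obtain d where d: "d > 0" "\<And>y. norm (y - x) < d \<Longrightarrow> norm (D y - D x - A (y - x)) \<le> e' * norm (y - x)"
    using D e' unfolding has_derivative_at_alt by blast
  obtain r where r: "r > 0" "ball x r \<subseteq> U" using U open_contains_ball by blast
  define \<delta> where "\<delta> = min d r / m"
  have \<delta>: "\<delta> > 0" using d r m by (simp add: \<delta>_def)
  have "dist (?Q t) (A w) < e" if t: "0 < t" "t < \<delta>" for t
  proof -
    have tm: "t * m < d" "t * m < r"
      using t m by (simp_all add: \<delta>_def pos_less_divide_eq)
    have bound: "norm (s *\<^sub>R v + k *\<^sub>R w) \<le> t * m" if "0 \<le> s" "s \<le> t" "0 \<le> k" "k \<le> t" for s k
    proof -
      have "norm (s *\<^sub>R v + k *\<^sub>R w) \<le> s * norm v + k * norm w"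
        using norm_triangle_ineq[of "s *\<^sub>R v" "k *\<^sub>R w"] that by simp
      also have "\<dots> \<le> t * norm v + t * norm w"
        using that by (intro add_mono mult_right_mono) auto
      also have "\<dots> \<le> t * m"
        using t by (simp add: m_def algebra_simps)
      finally show ?thesis .
    qed
    have inU: "x + s *\<^sub>R v + k *\<^sub>R w \<in> U" if "0 \<le> s" "s \<le> t" "0 \<le> k" "k \<le> t" for s k
    proof -
      have "dist x (x + s *\<^sub>R v + k *\<^sub>R w) = norm (s *\<^sub>R v + k *\<^sub>R w)"
        using norm_minus_cancel[of "s *\<^sub>R v + k *\<^sub>R w"] by (simp add: dist_norm add.assoc del: norm_minus_cancel)
      with bound[OF that] tm r show ?thesis by force
    qed
    have fd: "((\<lambda>s. f (x + s *\<^sub>R v + k *\<^sub>R w)) has_derivative (\<lambda>u. u *\<^sub>R D (x + s *\<^sub>R v + k *\<^sub>R w)))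
        (at s within {0..t})" if "0 \<le> s" "s \<le> t" "0 \<le> k" "k \<le> t" for s k
    proof -
      let ?y = "x + s *\<^sub>R v + k *\<^sub>R w"
      have dy: "f differentiable (at ?y)" using f inU[OF that] by simp
      then have "(f has_derivative frechet_derivative f (at ?y)) (at ?y)"
        by (simp add: frechet_derivative_works)
      moreover have "((\<lambda>s. x + s *\<^sub>R v + k *\<^sub>R w) has_derivative (\<lambda>u. u *\<^sub>R v)) (at s within {0..t})"
        by (auto intro!: derivative_eq_intros)
      ultimately have "((\<lambda>s. f (x + s *\<^sub>R v + k *\<^sub>R w)) has_derivative
          (\<lambda>u. frechet_derivative f (at ?y) (u *\<^sub>R v))) (at s within {0..t})"
        by (rule has_derivative_compose[rotated])
      then show ?thesis
        by (simp add: D_def linear_cmul[OF linear_frechet_derivative[OF dy]])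
    qed
    \<comment> \<open>Its increment over [0, t] is the second difference minus t^2 A w. Its
      derivative compares \<open>D\<close> at the two ends of the edge t w with the linear
      approximation, an error of 2 e' t m; the mean value inequality supplies the second factor
      t.\<close>
    define h where "h s = f (x + s *\<^sub>R v + t *\<^sub>R w) - f (x + s *\<^sub>R v + 0 *\<^sub>R w) - s *\<^sub>R (t *\<^sub>R A w)" for s
    have "norm (h t - h 0) \<le> (2 * e' * (t * m)) * norm (t - 0)"
    proof (rule differentiable_bound[where S = "{0..t}"])
      fix s assume s: "s \<in> {0..t}"
      show "(h has_derivative (\<lambda>u. u *\<^sub>R D (x + s *\<^sub>R v + t *\<^sub>R w) - u *\<^sub>R D (x + s *\<^sub>R v + 0 *\<^sub>R w) -
          u *\<^sub>R (t *\<^sub>R A w))) (at s within {0..t})"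
        unfolding h_def[abs_def] using s t by (intro has_derivative_diff fd has_derivative_scaleR_left has_derivative_ident) auto
      have "D (x + s *\<^sub>R v + t *\<^sub>R w) - D (x + s *\<^sub>R v + 0 *\<^sub>R w) - t *\<^sub>R A w =
          (D (x + s *\<^sub>R v + t *\<^sub>R w) - D x - A (s *\<^sub>R v + t *\<^sub>R w)) -
          (D (x + s *\<^sub>R v + 0 *\<^sub>R w) - D x - A (s *\<^sub>R v + 0 *\<^sub>R w))"
        by (simp add: linear_add[OF linA] linear_cmul[OF linA] linear_0[OF linA])
      also have "norm \<dots> \<le> norm (D (x + s *\<^sub>R v + t *\<^sub>R w) - D x - A (s *\<^sub>R v + t *\<^sub>R w)) +
          norm (D (x + s *\<^sub>R v + 0 *\<^sub>R w) - D x - A (s *\<^sub>R v + 0 *\<^sub>R w))"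
        by (rule norm_triangle_ineq4)
      also have "\<dots> \<le> e' * (t * m) + e' * (t * m)"
      proof (rule add_mono)
        have *: "norm (D (x + s *\<^sub>R v + k *\<^sub>R w) - D x - A (s *\<^sub>R v + k *\<^sub>R w)) \<le> e' * (t * m)"
          if "0 \<le> k" "k \<le> t" for k
        proof -
          have b: "norm (s *\<^sub>R v + k *\<^sub>R w) \<le> t * m" using s that by (intro bound) auto
          then have "norm (D (x + s *\<^sub>R v + k *\<^sub>R w) - D x - A (s *\<^sub>R v + k *\<^sub>R w)) \<le> e' * norm (s *\<^sub>R v + k *\<^sub>R w)"
            using d(2)[of "x + s *\<^sub>R v + k *\<^sub>R w"] tm by (simp add: add.assoc)
          also have "\<dots> \<le> e' * (t * m)" using b e' by (intro mult_left_mono) auto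
          finally show ?thesis .
        qed
        show "norm (D (x + s *\<^sub>R v + t *\<^sub>R w) - D x - A (s *\<^sub>R v + t *\<^sub>R w)) \<le> e' * (t * m)"
          "norm (D (x + s *\<^sub>R v + 0 *\<^sub>R w) - D x - A (s *\<^sub>R v + 0 *\<^sub>R w)) \<le> e' * (t * m)"
          using t by (intro *; simp)+
      qed
      finally have n: "norm (D (x + s *\<^sub>R v + t *\<^sub>R w) - D (x + s *\<^sub>R v + 0 *\<^sub>R w) - t *\<^sub>R A w) \<le> 2 * e' * (t * m)"
        by (simp add: mult_ac)
      show "onorm (\<lambda>u. u *\<^sub>R D (x + s *\<^sub>R v + t *\<^sub>R w) - u *\<^sub>R D (x + s *\<^sub>R v + 0 *\<^sub>R w) -
          u *\<^sub>R (t *\<^sub>R A w)) \<le> 2 * e' * (t * m)"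
      proof (rule onorm_le)
        fix u :: real
        have "norm (u *\<^sub>R (D (x + s *\<^sub>R v + t *\<^sub>R w) - D (x + s *\<^sub>R v + 0 *\<^sub>R w) - t *\<^sub>R A w)) \<le>
            2 * e' * (t * m) * norm u"
          using mult_left_mono[OF n, of "\<bar>u\<bar>"] by (simp add: mult_ac)
        then show "norm (u *\<^sub>R D (x + s *\<^sub>R v + t *\<^sub>R w) - u *\<^sub>R D (x + s *\<^sub>R v + 0 *\<^sub>R w) -
          u *\<^sub>R (t *\<^sub>R A w)) \<le> 2 * e' * (t * m) * norm u"
          by (simp add: scaleR_diff_right)
      qed
    qed (use t in auto)
    moreover have "h t - h 0 = t\<^sup>2 *\<^sub>R (?Q t - A w)"
    proof -
      have "t * t * (inverse t * inverse t) = 1" using t by (simp add: field_simps)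
      then show ?thesis by (simp add: h_def scaleR_diff_right power2_eq_square)
    qed
    ultimately have "t\<^sup>2 * norm (?Q t - A w) \<le> t\<^sup>2 * (2 * e' * m)"
      using t by (simp add: power2_eq_square mult_ac)
    then have "norm (?Q t - A w) \<le> 2 * e' * m" using t by simp
    also have "\<dots> < e" using e m by (simp add: e'_def)
    finally show ?thesis by (simp add: dist_norm)
  qed
  then show "\<forall>\<^sub>F t in at_right 0. dist (?Q t) (frechet_derivative (\<lambda>q. frechet_derivative f (at q) v) (at x) w) < e"
    unfolding eventually_at_right_field using \<delta> by (auto simp: A_def D_def[abs_def])
qed

lemma second_derivative_symmetric:
  fixes f :: "'a::euclidean_space \<Rightarrow> 'b::real_normed_vector"
  assumes U: "open U" "x \<in> U" and f: "ck_on 2 U f"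
  shows "frechet_derivative (\<lambda>q. frechet_derivative f (at q) v) (at x) w =
    frechet_derivative (\<lambda>q. frechet_derivative f (at q) w) (at x) v"
proof (rule tendsto_unique[OF _ second_difference_tendsto[OF assms]])
  have "(\<lambda>t::real. (f (x + t *\<^sub>R w + t *\<^sub>R v) - f (x + t *\<^sub>R w) - f (x + t *\<^sub>R v) + f x) /\<^sub>R t\<^sup>2) =
      (\<lambda>t. (f (x + t *\<^sub>R v + t *\<^sub>R w) - f (x + t *\<^sub>R v) - f (x + t *\<^sub>R w) + f x) /\<^sub>R t\<^sup>2)"
    by (simp add: algebra_simps)
  then show "((\<lambda>t. (f (x + t *\<^sub>R v + t *\<^sub>R w) - f (x + t *\<^sub>R v) - f (x + t *\<^sub>R w) + f x) /\<^sub>R t\<^sup>2) \<longlongrightarrow>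
      frechet_derivative (\<lambda>q. frechet_derivative f (at q) w) (at x) v) (at_right (0::real))"
    using second_difference_tendsto[OF assms, of w v] by simp
qed simp

section \<open>Tangent spaces\<close>

text \<open>Every linear functional vanishing on \<open>E\<close> vanishes along the curve, hence on
  its velocity; and \<open>E\<close> is its own double orthogonal complement.\<close>

lemma has_vector_derivative_in_subspace:
  fixes g :: "real \<Rightarrow> 'b::euclidean_space"
  assumes g: "(g has_vector_derivative g') (at x)" and S: "open S" "x \<in> S" "\<And>t. t \<in> S \<Longrightarrow> g t \<in> E"
    and E: "subspace E"
  shows "g' \<in> E"
proof -
  have "g' \<bullet> u = 0" if u: "\<And>y. y \<in> E \<Longrightarrow> y \<bullet> u = 0" for u
  proof -
    have "((\<lambda>t. g t \<bullet> u) has_vector_derivative g' \<bullet> u) (at x)"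
      by (rule bounded_linear.has_vector_derivative[OF bounded_linear_inner_left g])
    moreover have "((\<lambda>t. g t \<bullet> u) has_vector_derivative 0) (at x)"
      by (rule has_vector_derivative_transform_within_open[OF has_vector_derivative_const S(1,2)])
        (simp add: u S(3))
    ultimately show ?thesis by (rule vector_derivative_unique_at)
  qed
  then have "g' \<in> E\<^sup>\<bottom>\<^sup>\<bottom>"
    by (simp add: orthogonal_comp_def orthogonal_def inner_commute)
  then show ?thesis by (simp add: orthogonal_comp_self[OF E])
qed

lemma tangent_spaceE:
  assumes "v \<in> tangent_space M p"
  obtains \<gamma> S where "open S" "(0::real) \<in> S" "\<And>t. t \<in> S \<Longrightarrow> \<gamma> t \<in> M" "\<gamma> 0 = p"
    "(\<gamma> has_vector_derivative v) (at 0)"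
proof -
  obtain \<gamma> \<epsilon> where "\<epsilon> > 0" "\<gamma> ` {-\<epsilon><..<\<epsilon>} \<subseteq> M" "\<gamma> 0 = p" "(\<gamma> has_vector_derivative v) (at (0::real))"
    using assms by (auto simp: tangent_space_def)
  then show thesis by (intro that[of "{-\<epsilon><..<\<epsilon>}" \<gamma>]) auto
qed

lemma has_derivative_within_along_curve:
  assumes Y: "(Y has_derivative D) (at p within M)"
    and S: "open S" "0 \<in> S" "\<And>t. t \<in> S \<Longrightarrow> \<gamma> t \<in> M" and \<gamma>: "\<gamma> 0 = p" "(\<gamma> has_vector_derivative v) (at (0::real))"
  shows "((\<lambda>t. Y (\<gamma> t)) has_vector_derivative D v) (at 0)"
proof -
  have "(\<gamma> has_derivative (\<lambda>t. t *\<^sub>R v)) (at 0 within S)"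
    using \<gamma>(2) by (simp add: has_vector_derivative_def has_derivative_at_withinI)
  moreover have "(Y has_derivative D) (at (\<gamma> 0) within \<gamma> ` S)"
    unfolding \<gamma>(1) by (rule has_derivative_subset[OF Y]) (use S(3) in auto)
  ultimately have "(Y \<circ> \<gamma> has_derivative D \<circ> (\<lambda>t. t *\<^sub>R v)) (at 0 within S)"
    by (rule diff_chain_within)
  then show ?thesis
    using has_derivative_linear[OF Y] at_within_open[OF S(2,1)]
    by (simp add: has_vector_derivative_def o_def linear_cmul)
qed

text \<open>For a curve \<gamma> in \<open>M\<close> with velocity \<open>v\<close>, both values are
  the derivative of \<open>Y\<close> along \<gamma> at time 0.\<close>

lemma has_derivative_within_unique_tangent:
  assumes "(Y has_derivative D) (at p within M)" "(Y has_derivative D') (at p within M)"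
    "v \<in> tangent_space M p"
  shows "D v = D' v"
proof -
  obtain \<gamma> S where "open S" "(0::real) \<in> S" "\<And>t. t \<in> S \<Longrightarrow> \<gamma> t \<in> M" "\<gamma> 0 = p"
    "(\<gamma> has_vector_derivative v) (at 0)"
    using assms(3) by (rule tangent_spaceE) (rule that; assumption)
  from has_derivative_within_along_curve[OF assms(1) this] has_derivative_within_along_curve[OF assms(2) this]
  show ?thesis by (rule vector_derivative_unique_at)
qed

text \<open>The derivative of an ambient extension, restricted to \<open>M\<close>, is one of the
  candidates for the derivative within \<open>M\<close>; on tangent vectors all candidates
  agree.\<close>

lemma frechet_derivative_within_extension:
  assumes G: "G differentiable (at p)" and p: "p \<in> M" "open U" "p \<in> U"
    and eq: "\<And>q. q \<in> M \<inter> U \<Longrightarrow> G q = Y q" and v: "v \<in> tangent_space M p"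
  shows "frechet_derivative Y (at p within M) v = frechet_derivative G (at p) v"
proof -
  obtain e where e: "e > 0" "ball p e \<subseteq> U" using p open_contains_ball by blast
  have "(G has_derivative frechet_derivative G (at p)) (at p within M)"
    using G by (simp add: frechet_derivative_works has_derivative_at_withinI)
  then have Y: "(Y has_derivative frechet_derivative G (at p)) (at p within M)"
    by (rule has_derivative_transform_within[where d = e]) (use e p in \<open>auto simp: dist_commute subset_iff intro!: eq\<close>)
  then have "Y differentiable (at p within M)" by (auto simp: differentiable_def)
  then have "(Y has_derivative frechet_derivative Y (at p within M)) (at p within M)"
    by (simp add: frechet_derivative_works)
  from has_derivative_within_unique_tangent[OF this Y v] show ?thesis .
qed

text \<open>A curve in \<open>M\<close> maps to a curve in \<open>E\<close>, so its velocity maps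
  into \<open>E\<close>; conversely a line in \<open>E\<close> pulls back to a curve in
  \<open>M\<close>. The description of tangent vectors holds at all points of
  \<open>U \<inter> M\<close>, since fields are later differentiated along \<open>M\<close>.\<close>

lemma submanifold_chart:
  fixes M :: "'a::euclidean_space set"
  assumes M: "submanifold \<kappa> d M" "order_at_least 2 \<kappa>" "p \<in> M"
  obtains U and \<Phi> :: "'a \<Rightarrow> 'a" and E where "open U" "p \<in> U" "ck_on 2 U \<Phi>" "subspace E" "dim E = d"
    "\<And>q. q \<in> U \<Longrightarrow> bij (frechet_derivative \<Phi> (at q))"
    "\<And>q. q \<in> U \<inter> M \<Longrightarrow> tangent_space M q = {v. frechet_derivative \<Phi> (at q) v \<in> E}"
proof -
  obtain U W and \<Phi> \<Psi> :: "'a \<Rightarrow> 'a" and E where c: "open U" "p \<in> U" "open W" "homeomorphism U W \<Phi> \<Psi>"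
    "class_on \<kappa> U \<Phi>" "class_on \<kappa> W \<Psi>" "subspace E" "dim E = d" "\<Phi> ` (U \<inter> M) = W \<inter> E"
    using M(1,3) unfolding submanifold_def by meson
  have \<Phi>: "ck_on 2 U \<Phi>" and \<Psi>: "ck_on 2 W \<Psi>"
    using class_on_imp_ck_on[OF _ M(2)] c by blast+
  have d\<Phi>: "(\<Phi> has_derivative frechet_derivative \<Phi> (at q)) (at q)" if "q \<in> U" for q
    using \<Phi> that by (simp add: numeral_2_eq_2 frechet_derivative_works[symmetric])
  have d\<Psi>: "(\<Psi> has_derivative frechet_derivative \<Psi> (at q)) (at q)" if "q \<in> W" for q
    using \<Psi> that by (simp add: numeral_2_eq_2 frechet_derivative_works[symmetric])
  have \<Psi>\<Phi>: "\<Psi> (\<Phi> q) = q" "\<Phi> q \<in> W" if "q \<in> U" for q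
    using c(4) that by (auto simp: homeomorphism_def)
  have \<Phi>\<Psi>: "\<Phi> (\<Psi> q) = q" "\<Psi> q \<in> U" if "q \<in> W" for q
    using c(4) that by (auto simp: homeomorphism_def)
  have inv1: "frechet_derivative \<Psi> (at (\<Phi> q)) (frechet_derivative \<Phi> (at q) v) = v" if q: "q \<in> U" for q v
  proof -
    have "((\<lambda>x. \<Psi> (\<Phi> x)) has_derivative (\<lambda>v. frechet_derivative \<Psi> (at (\<Phi> q)) (frechet_derivative \<Phi> (at q) v))) (at q)"
      by (rule has_derivative_compose[OF d\<Phi>[OF q] d\<Psi>[OF \<Psi>\<Phi>(2)[OF q]]])
    moreover have "((\<lambda>x. \<Psi> (\<Phi> x)) has_derivative (\<lambda>v. v)) (at q)"
      by (rule has_derivative_transform_within_open[OF has_derivative_ident c(1) q]) (simp add: \<Psi>\<Phi>)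
    ultimately show ?thesis using has_derivative_unique by metis
  qed
  have inv2: "frechet_derivative \<Phi> (at q) (frechet_derivative \<Psi> (at (\<Phi> q)) v) = v" if q: "q \<in> U" for q v
  proof -
    have "((\<lambda>x. \<Phi> (\<Psi> x)) has_derivative (\<lambda>v. frechet_derivative \<Phi> (at (\<Psi> (\<Phi> q))) (frechet_derivative \<Psi> (at (\<Phi> q)) v))) (at (\<Phi> q))"
      using \<Psi>\<Phi>[OF q] by (intro has_derivative_compose[OF d\<Psi>] d\<Phi>) (auto simp: q)
    moreover have "((\<lambda>x. \<Phi> (\<Psi> x)) has_derivative (\<lambda>v. v)) (at (\<Phi> q))"
      by (rule has_derivative_transform_within_open[OF has_derivative_ident c(3) \<Psi>\<Phi>(2)[OF q]]) (simp add: \<Phi>\<Psi>)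
    ultimately show ?thesis using has_derivative_unique \<Psi>\<Phi>[OF q] by metis
  qed
  have tan: "tangent_space M q = {v. frechet_derivative \<Phi> (at q) v \<in> E}" if q: "q \<in> U" "q \<in> M" for q
  proof (intro equalityI subsetI CollectI)
    fix v assume "v \<in> tangent_space M q"
    then obtain \<gamma> S where \<gamma>: "open S" "(0::real) \<in> S" "\<And>t. t \<in> S \<Longrightarrow> \<gamma> t \<in> M" "\<gamma> 0 = q"
      "(\<gamma> has_vector_derivative v) (at 0)"
      by (rule tangent_spaceE) (rule that; assumption)
    have "isCont \<gamma> 0" using \<gamma>(5) has_vector_derivative_continuous by blast
    \<comment> \<open>A shorter time interval keeps the curve inside the chart domain, the only
      place where \<open>\<Phi>\<close> sends \<open>M\<close> into \<open>E\<close>.\<close>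
    then obtain S' where S': "open S'" "0 \<in> S'" "\<And>t. t \<in> S' \<Longrightarrow> \<gamma> t \<in> U"
      using c(1) \<gamma>(4) q(1) unfolding continuous_at_open by metis
    have "((\<lambda>t. \<Phi> (\<gamma> t)) has_vector_derivative frechet_derivative \<Phi> (at q) v) (at 0)"
      by (rule has_derivative_within_along_curve[OF has_derivative_at_withinI[OF d\<Phi>[OF q(1)]] \<gamma>])
    then show "frechet_derivative \<Phi> (at q) v \<in> E"
      by (rule has_vector_derivative_in_subspace[of _ _ _ "S \<inter> S'"]) (use \<gamma> S' c(7,9) in auto)
  next
    fix v assume "v \<in> {v. frechet_derivative \<Phi> (at q) v \<in> E}"
    then have w: "frechet_derivative \<Phi> (at q) v \<in> E" (is "?w \<in> E") by simp
    \<comment> \<open>The straight line through \<open>\<Phi> q\<close> in the direction of the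
      image of \<open>v\<close>; its pullback by \<open>\<Psi>\<close> is the curve required by
      \<open>tangent_space\<close>.\<close>
    let ?\<gamma> = "\<lambda>t::real. \<Phi> q + t *\<^sub>R ?w"
    have "open (?\<gamma> -` W)"
      by (intro open_vimage c(3) continuous_intros)
    moreover have "0 \<in> ?\<gamma> -` W" using \<Psi>\<Phi>(2)[OF q(1)] by simp
    ultimately obtain \<epsilon> where \<epsilon>: "\<epsilon> > 0" "ball 0 \<epsilon> \<subseteq> ?\<gamma> -` W"
      using open_contains_ball by meson
    have ball: "ball 0 \<epsilon> = {-\<epsilon><..<\<epsilon>}" by (auto simp: dist_real_def)
    have W: "?\<gamma> t \<in> W" if "t \<in> {-\<epsilon><..<\<epsilon>}" for t using \<epsilon>(2) that unfolding ball by auto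
    have lin: "linear (frechet_derivative \<Psi> (at x))" if "x \<in> W" for x
      using d\<Psi>[OF that] by (rule has_derivative_linear)
    have d: "((\<lambda>t. \<Psi> (?\<gamma> t)) has_derivative (\<lambda>s. s *\<^sub>R frechet_derivative \<Psi> (at (?\<gamma> t)) ?w)) (at t)"
      if t: "t \<in> {-\<epsilon><..<\<epsilon>}" for t
    proof -
      have "(?\<gamma> has_derivative (\<lambda>s. s *\<^sub>R ?w)) (at t)"
        by (auto intro!: derivative_eq_intros)
      from has_derivative_compose[OF this d\<Psi>[OF W[OF t]]] show ?thesis
        by (simp add: linear_cmul[OF lin[OF W[OF t]]])
    qed
    have "class_on (Ck 1) {-\<epsilon><..<\<epsilon>} (\<lambda>t. \<Psi> (?\<gamma> t))"
    proof -
      have "continuous_on {-\<epsilon><..<\<epsilon>} (\<lambda>t. frechet_derivative (\<lambda>t. \<Psi> (?\<gamma> t)) (at t) s)" for s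
      proof -
        have "ck_on (Suc 0) W (\<lambda>x. frechet_derivative \<Psi> (at x) ?w)"
          using \<Psi> by (simp add: numeral_2_eq_2)
        then have "continuous_on W (\<lambda>x. frechet_derivative \<Psi> (at x) ?w)"
          by (rule ck_on_Suc_continuous)
        then have "continuous_on {-\<epsilon><..<\<epsilon>} (\<lambda>t. frechet_derivative \<Psi> (at (?\<gamma> t)) ?w)"
          by (rule continuous_on_compose2) (use W in \<open>auto intro!: continuous_intros\<close>)
        then have "continuous_on {-\<epsilon><..<\<epsilon>} (\<lambda>t. s *\<^sub>R frechet_derivative \<Psi> (at (?\<gamma> t)) ?w)"
          by (intro continuous_on_scaleR continuous_on_const)
        then show ?thesis
          by (rule continuous_on_eq) (simp add: frechet_derivative_at[OF d, symmetric])
      qed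
      moreover have "(\<lambda>t. \<Psi> (?\<gamma> t)) differentiable (at t)" if "t \<in> {-\<epsilon><..<\<epsilon>}" for t
        using d[OF that] by (rule differentiableI)
      ultimately show ?thesis by (simp add: class_on_def)
    qed
    moreover have "\<Psi> (?\<gamma> t) \<in> M" if "t \<in> {-\<epsilon><..<\<epsilon>}" for t
    proof -
      have "\<Phi> q \<in> E" using c(9) q by blast
      then have "?\<gamma> t \<in> W \<inter> E" using W[OF that] w c(7) by (auto intro: subspace_add subspace_mul)
      then obtain m where "m \<in> U \<inter> M" "?\<gamma> t = \<Phi> m" using c(9) by (metis imageE)
      then show ?thesis using \<Psi>\<Phi> by auto
    qed
    moreover have "((\<lambda>t. \<Psi> (?\<gamma> t)) has_vector_derivative v) (at 0)"
      using d[of 0] \<epsilon>(1) inv1[OF q(1), of v] by (simp add: has_vector_derivative_def)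
    ultimately show "v \<in> tangent_space M q"
      unfolding tangent_space_def using \<epsilon>(1) \<Psi>\<Phi>[OF q(1)]
      by (intro CollectI exI[of _ "\<lambda>t. \<Psi> (?\<gamma> t)"] exI[of _ \<epsilon>]) auto
  qed
  show thesis
  proof (rule that[OF c(1,2) \<Phi> c(7,8)])
    show "bij (frechet_derivative \<Phi> (at q))" if "q \<in> U" for q
      using inv1[OF that] inv2[OF that] by (intro o_bij[of "frechet_derivative \<Psi> (at (\<Phi> q))"]) auto
  qed (use tan in auto)
qed

text \<open>In a chart the tangent space is the preimage of the linear space \<open>E\<close> under
  a linear isomorphism.\<close>

lemma subspace_tangent_space:
  fixes M :: "'a::euclidean_space set"
  assumes M: "submanifold \<kappa> d M" "order_at_least 2 \<kappa>" "p \<in> M"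
  shows "subspace (tangent_space M p)" "dim (tangent_space M p) = d"
proof -
  obtain U and \<Phi> :: "'a \<Rightarrow> 'a" and E where c: "open U" "p \<in> U" "ck_on 2 U \<Phi>" "subspace E" "dim E = d"
    "bij (frechet_derivative \<Phi> (at p))"
    "tangent_space M p = {v. frechet_derivative \<Phi> (at p) v \<in> E}"
  proof (rule submanifold_chart[OF M])
    fix U E and \<Phi> :: "'a \<Rightarrow> 'a"
    assume "open U" "p \<in> U" "ck_on 2 U \<Phi>" "subspace E" "dim E = d"
      "\<And>q. q \<in> U \<Longrightarrow> bij (frechet_derivative \<Phi> (at q))"
      "\<And>q. q \<in> U \<inter> M \<Longrightarrow> tangent_space M q = {v. frechet_derivative \<Phi> (at q) v \<in> E}"
    then show thesis using M(3) by (intro that[of U \<Phi> E]) auto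
  qed
  let ?D = "frechet_derivative \<Phi> (at p)"
  have lin: "linear ?D"
    using c(1-3) by (intro linear_frechet_derivative) (simp add: numeral_2_eq_2)
  show "subspace (tangent_space M p)"
    unfolding c(7) by (rule linear_subspace_linear_preimage[OF lin c(4), unfolded vimage_def])
  have "?D ` tangent_space M p = E"
    unfolding c(7) using bij_is_surj[OF c(6)] by (auto simp: surj_def)
  then show "dim (tangent_space M p) = d"
    using dim_image_eq[OF lin, of "tangent_space M p"] bij_is_inj[OF c(6)] c(5)
    by (metis inj_on_subset subset_UNIV)
qed

text \<open>With a chart \<open>\<Phi>\<close> flattening \<open>M\<close> to \<open>E\<close>, differentiate \<open>d\<Phi>(Y) \<in> E\<close> along \<open>X\<close> and
  \<open>d\<Phi>(X) \<in> E\<close> along \<open>Y\<close>; the second derivatives of \<open>\<Phi>\<close> cancel by symmetry.\<close>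

lemma real_bracket_tangent:
  fixes M :: "'a::euclidean_space set"
  assumes M: "submanifold \<kappa> d M" "order_at_least 2 \<kappa>" "p \<in> M" and N: "open N" "p \<in> N"
    and X: "(X has_derivative X') (at p)" "\<And>q. q \<in> M \<inter> N \<Longrightarrow> X q \<in> tangent_space M q"
    and Y: "(Y has_derivative Y') (at p)" "\<And>q. q \<in> M \<inter> N \<Longrightarrow> Y q \<in> tangent_space M q"
  shows "Y' (X p) - X' (Y p) \<in> tangent_space M p"
proof -
  obtain U and \<Phi> :: "'a \<Rightarrow> 'a" and E where c: "open U" "p \<in> U" "ck_on 2 U \<Phi>" "subspace E"
    "\<And>q. q \<in> U \<inter> M \<Longrightarrow> tangent_space M q = {v. frechet_derivative \<Phi> (at q) v \<in> E}"
    by (rule submanifold_chart[OF M]) (rule that; assumption)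
  define D where "D q = frechet_derivative \<Phi> (at q)" for q
  define H where "H v w = frechet_derivative (\<lambda>q. D q v) (at p) w" for v w
  \<comment> \<open>Stated for a general field and direction, because it is applied to
    \<open>Y\<close> along \<open>X p\<close> and to \<open>X\<close> along
    \<open>Y p\<close>.\<close>
  have *: "D p (Z' w) + H (Z p) w \<in> E"
    if Z: "(Z has_derivative Z') (at p)" "\<And>q. q \<in> M \<inter> N \<Longrightarrow> Z q \<in> tangent_space M q"
      and w: "w \<in> tangent_space M p" for Z Z' w
  proof -
    have dz: "((\<lambda>q. D q (Z q)) has_derivative (\<lambda>w. D p (Z' w) + H (Z p) w)) (at p within M)"
      unfolding D_def H_def
      by (rule has_derivative_at_withinI, rule has_derivative_frechet_derivative_along[OF c(1,2,3) Z(1)])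
    obtain \<gamma> S where \<gamma>: "open S" "(0::real) \<in> S" "\<And>t. t \<in> S \<Longrightarrow> \<gamma> t \<in> M" "\<gamma> 0 = p"
      "(\<gamma> has_vector_derivative w) (at 0)"
      using w by (rule tangent_spaceE) (rule that; assumption)
    have "isCont \<gamma> 0" using \<gamma>(5) has_vector_derivative_continuous by blast
    moreover have "open (U \<inter> N)" "\<gamma> 0 \<in> U \<inter> N" using c N \<gamma>(4) by auto
    ultimately obtain S' where S': "open S'" "0 \<in> S'" "\<And>t. t \<in> S' \<Longrightarrow> \<gamma> t \<in> U \<inter> N"
      unfolding continuous_at_open by metis
    show ?thesis
    proof (rule has_vector_derivative_in_subspace[OF _ _ _ _ c(4)])
      show "((\<lambda>t. D (\<gamma> t) (Z (\<gamma> t))) has_vector_derivative D p (Z' w) + H (Z p) w) (at 0)"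
        by (rule has_derivative_within_along_curve[OF dz \<gamma>])
      show "open (S \<inter> S')" "0 \<in> S \<inter> S'" using \<gamma> S' by auto
      show "D (\<gamma> t) (Z (\<gamma> t)) \<in> E" if "t \<in> S \<inter> S'" for t
        using Z(2)[of "\<gamma> t"] c(5)[of "\<gamma> t"] \<gamma>(3)[of t] S'(3)[of t] that by (auto simp: D_def)
    qed
  qed
  have p: "X p \<in> tangent_space M p" "Y p \<in> tangent_space M p" using X Y M(3) N by auto
  have sym: "H (X p) (Y p) = H (Y p) (X p)"
    unfolding H_def D_def by (rule second_derivative_symmetric[OF c(1-3)])
  have lin: "linear (D p)"
    unfolding D_def using c(1-3) by (intro linear_frechet_derivative) (simp add: numeral_2_eq_2)
  have "(D p (Y' (X p)) + H (Y p) (X p)) - (D p (X' (Y p)) + H (X p) (Y p)) \<in> E"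
    by (intro subspace_diff c(4) * X Y p)
  then have "D p (Y' (X p) - X' (Y p)) \<in> E" by (simp add: sym linear_diff[OF lin])
  then show ?thesis using c(2,5) M(3) by (auto simp: D_def)
qed

section \<open>Brackets of complex vector fields\<close>

lemma bounded_bilinear_cscale:
  "bounded_bilinear (cscale :: complex \<Rightarrow> 'a::euclidean_space \<times> 'a \<Rightarrow> 'a \<times> 'a)"
  unfolding bilinear_conv_bounded_bilinear[symmetric] bilinear_def
  by (intro conjI allI linearI) (auto simp: cscale_def algebra_simps)

lemma bounded_linear_cscale_right:
  "bounded_linear (\<lambda>X :: 'a::euclidean_space \<times> 'a. c *\<^sub>C X)"
  by (rule bounded_bilinear.bounded_linear_right[OF bounded_bilinear_cscale])

lemma bounded_linear_cconj: "bounded_linear (cconj :: 'a::euclidean_space \<times> 'a \<Rightarrow> 'a \<times> 'a)"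
  unfolding linear_conv_bounded_linear[symmetric]
  by (rule linearI) (auto simp: cconj_def)

lemma cconj_cscale: "cconj (c *\<^sub>C X) = cnj c *\<^sub>C cconj X"
  by (simp add: cscale_def cconj_def)

text \<open>The function X(h): a complex vector acting as a derivation on a complex function, the
  scalar counterpart of \<open>covariant\<close>.\<close>

definition cdir :: "('a::euclidean_space \<Rightarrow> complex) \<Rightarrow> 'a \<Rightarrow> 'a \<times> 'a \<Rightarrow> complex" where
  "cdir h p X = frechet_derivative h (at p) (fst X) + \<i> * frechet_derivative h (at p) (snd X)"

text \<open>With \<open>UNIV\<close> in place of \<open>M\<close> the derivative is the ordinary
  one. Ambient brackets thus come from the same definition as those on \<open>M\<close>, and the
  usual calculus holds for them.\<close>

lemma covariant_has_derivative:
  assumes "(Y has_derivative Y') (at p)"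
  shows "covariant UNIV X Y p = Y' (fst (X p)) + \<i> *\<^sub>C Y' (snd (X p))"
  unfolding covariant_def frechet_derivative_at[OF assms, symmetric] ..

lemma covariant_cscale_left:
  fixes Y :: "'a::euclidean_space \<Rightarrow> 'a \<times> 'a"
  assumes "Y differentiable (at p)"
  shows "covariant UNIV (\<lambda>q. a q *\<^sub>C X q) Y p = a p *\<^sub>C covariant UNIV X Y p"
proof -
  note l = linear_frechet_derivative[OF assms]
  show ?thesis
    unfolding covariant_def cscale_def
    by (simp add: linear_add[OF l] linear_diff[OF l] linear_cmul[OF l] prod_eq_iff algebra_simps)
qed

lemma covariant_add_left:
  fixes Y :: "'a::euclidean_space \<Rightarrow> 'a \<times> 'a"
  assumes "Y differentiable (at p)"
  shows "covariant UNIV (\<lambda>q. X q + Z q) Y p = covariant UNIV X Y p + covariant UNIV Z Y p"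
  unfolding covariant_def
  by (simp add: linear_add[OF linear_frechet_derivative[OF assms]] cplx.scale_right_distrib algebra_simps)

lemma covariant_cscale_right:
  fixes Y :: "'a::euclidean_space \<Rightarrow> 'a \<times> 'a"
  assumes a: "a differentiable (at p)" and Y: "Y differentiable (at p)"
  shows "covariant UNIV X (\<lambda>q. a q *\<^sub>C Y q) p = a p *\<^sub>C covariant UNIV X Y p + cdir a p (X p) *\<^sub>C Y p"
proof -
  have "((\<lambda>q. a q *\<^sub>C Y q) has_derivative
    (\<lambda>v. a p *\<^sub>C frechet_derivative Y (at p) v + frechet_derivative a (at p) v *\<^sub>C Y p)) (at p)"
    using a Y by (intro bounded_bilinear.FDERIV[OF bounded_bilinear_cscale])
      (simp_all add: frechet_derivative_works)
  from covariant_has_derivative[OF this] show ?thesis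
    by (simp add: covariant_def cdir_def cplx.scale_right_distrib cplx.scale_left_distrib mult.commute)
qed

lemma covariant_add_right:
  fixes Y :: "'a::euclidean_space \<Rightarrow> 'a \<times> 'a"
  assumes Z: "Z differentiable (at p)" and Y: "Y differentiable (at p)"
  shows "covariant UNIV X (\<lambda>q. Y q + Z q) p = covariant UNIV X Y p + covariant UNIV X Z p"
proof -
  have "((\<lambda>q. Y q + Z q) has_derivative
    (\<lambda>v. frechet_derivative Y (at p) v + frechet_derivative Z (at p) v)) (at p)"
    using Y Z by (intro has_derivative_add) (simp_all add: frechet_derivative_works)
  from covariant_has_derivative[OF this] show ?thesis
    by (simp add: covariant_def cplx.scale_right_distrib)
qed

text \<open>Leibniz rule in both arguments at once; constant coefficients are the case where the
  \<open>cdir\<close> terms vanish.\<close>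

lemma lie_bracket_cscale:
  fixes X Y :: "'a::euclidean_space \<Rightarrow> 'a \<times> 'a"
  assumes "a differentiable (at p)" "b differentiable (at p)" "X differentiable (at p)" "Y differentiable (at p)"
  shows "lie_bracket UNIV (\<lambda>q. a q *\<^sub>C X q) (\<lambda>q. b q *\<^sub>C Y q) p =
    (a p * b p) *\<^sub>C lie_bracket UNIV X Y p + (a p * cdir b p (X p)) *\<^sub>C Y p - (b p * cdir a p (Y p)) *\<^sub>C X p"
proof -
  have d: "(\<lambda>q. a q *\<^sub>C X q) differentiable (at p)" "(\<lambda>q. b q *\<^sub>C Y q) differentiable (at p)"
    using assms bounded_bilinear.FDERIV[OF bounded_bilinear_cscale]
    unfolding differentiable_def by blast+
  show ?thesis
    unfolding lie_bracket_def covariant_cscale_left[OF d(1)] covariant_cscale_left[OF d(2)]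
      covariant_cscale_right[OF assms(1,3)] covariant_cscale_right[OF assms(2,4)]
    by (simp add: cplx.scale_right_distrib cplx.scale_right_diff_distrib mult.commute)
qed

lemma lie_bracket_add_right:
  fixes X Y Z :: "'a::euclidean_space \<Rightarrow> 'a \<times> 'a"
  assumes "X differentiable (at p)" "Y differentiable (at p)" "Z differentiable (at p)"
  shows "lie_bracket UNIV X (\<lambda>q. Y q + Z q) p = lie_bracket UNIV X Y p + lie_bracket UNIV X Z p"
  unfolding lie_bracket_def covariant_add_right[OF assms(3,2)] covariant_add_left[OF assms(1)]
  by simp

lemma lie_bracket_self: "lie_bracket M X X p = 0"
  by (simp add: lie_bracket_def)

lemma lie_bracket_cong_open:
  fixes X Y :: "'a::euclidean_space \<Rightarrow> 'a \<times> 'a"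
  assumes U: "open U" "p \<in> U" and d: "X differentiable (at p)" "Y differentiable (at p)"
    and eq: "\<And>q. q \<in> U \<Longrightarrow> X q = X' q" "\<And>q. q \<in> U \<Longrightarrow> Y q = Y' q"
  shows "lie_bracket UNIV X Y p = lie_bracket UNIV X' Y' p"
proof -
  have "frechet_derivative X (at p) = frechet_derivative X' (at p)"
    "frechet_derivative Y (at p) = frechet_derivative Y' (at p)"
    using frechet_derivative_transform_within_open[OF d(1) U eq(1)]
      frechet_derivative_transform_within_open[OF d(2) U eq(2)] by auto
  then show ?thesis using eq U by (simp add: lie_bracket_def covariant_def)
qed

text \<open>Derivatives in real directions commute with \<open>cnj\<close>, and conjugating the
  factor \<i> amounts to flipping the imaginary part of \<open>X\<close>. This relates the
  coefficients of L and cnj L in T'.\<close>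

lemma cdir_cnj:
  fixes h :: "'a::euclidean_space \<Rightarrow> complex"
  assumes "h differentiable (at p)"
  shows "cdir (\<lambda>q. cnj (h q)) p X = cnj (cdir h p (cconj X))"
proof -
  have "((\<lambda>q. cnj (h q)) has_derivative (\<lambda>v. cnj (frechet_derivative h (at p) v))) (at p)"
    using assms by (intro bounded_linear.has_derivative[OF bounded_linear_cnj])
      (simp add: frechet_derivative_works)
  from frechet_derivative_at[OF this, symmetric] show ?thesis
    by (simp add: cdir_def cconj_def linear_neg[OF linear_frechet_derivative[OF assms]])
qed

lemma class_on_covariant:
  fixes X Y :: "'a::euclidean_space \<Rightarrow> 'a \<times> 'a"
  assumes U: "open U" and Y: "class_on \<kappa> U Y" "order_at_least 1 \<kappa>" and X: "class_on (drop_class \<kappa> 1) U X"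
  shows "class_on (drop_class \<kappa> 1) U (covariant UNIV X Y)"
  unfolding covariant_def[abs_def]
  by (intro class_on_add[OF U] class_on_bounded_linear[OF bounded_linear_cscale_right U]
      class_on_derivative_along[OF U Y] class_on_bounded_linear[OF bounded_linear_fst U X]
      class_on_bounded_linear[OF bounded_linear_snd U X])

lemma class_on_lie_bracket:
  fixes X Y :: "'a::euclidean_space \<Rightarrow> 'a \<times> 'a"
  assumes U: "open U" and k: "order_at_least 1 \<kappa>" and Y: "class_on \<kappa> U Y" and X: "class_on \<kappa> U X"
  shows "class_on (drop_class \<kappa> 1) U (lie_bracket UNIV X Y)"
proof -
  \<comment> \<open>\<open>drop_class \<kappa> 0\<close> is \<kappa>, which brings the hypothesis
    into the form of \<open>class_on_drop_mono\<close>.\<close>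
  have X0: "class_on (drop_class \<kappa> 0) U X" using X by (cases \<kappa>) auto
  have X1: "class_on (drop_class \<kappa> 1) U X" using class_on_drop_mono[OF X0, of 1] by simp
  have Y0: "class_on (drop_class \<kappa> 0) U Y" using Y by (cases \<kappa>) auto
  have Y1: "class_on (drop_class \<kappa> 1) U Y" using class_on_drop_mono[OF Y0, of 1] by simp
  have "class_on (drop_class \<kappa> 1) U (\<lambda>p. covariant UNIV X Y p + - covariant UNIV Y X p)"
    by (intro class_on_add[OF U] class_on_covariant[OF U Y k X1]
        class_on_bounded_linear[OF bounded_linear_minus[OF bounded_linear_ident] U]
        class_on_covariant[OF U X k Y1])
  then show ?thesis by (simp add: lie_bracket_def[abs_def])
qed

text \<open>Each derivative in the bracket is taken along the value of the other field; as these
  values are tangent, the derivatives within \<open>M\<close> agree with those of the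
  extensions.\<close>

lemma lie_bracket_extension:
  assumes p: "p \<in> M" "open U" "p \<in> U" and d: "F differentiable (at p)" "G differentiable (at p)"
    and eq: "\<And>q. q \<in> M \<inter> U \<Longrightarrow> F q = X q" "\<And>q. q \<in> M \<inter> U \<Longrightarrow> G q = Y q"
    and t: "X p \<in> ctangent_space M p" "Y p \<in> ctangent_space M p"
  shows "lie_bracket M X Y p = lie_bracket UNIV F G p"
proof -
  have "F p = X p" "G p = Y p" using eq p by auto
  moreover have "frechet_derivative X (at p within M) v = frechet_derivative F (at p) v"
    "frechet_derivative Y (at p within M) v = frechet_derivative G (at p) v"
    if "v \<in> tangent_space M p" for v
    using frechet_derivative_within_extension[OF d(1) p, of X v]
      frechet_derivative_within_extension[OF d(2) p, of Y v] eq that by blast+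
  ultimately show ?thesis
    using t unfolding lie_bracket_def covariant_def
    by (simp add: ctangent_space_def mem_Times_iff)
qed

text \<open>The real part of [F, G] is [Re F, Re G] - [Im F, Im G] and the imaginary part is
  [Re F, Im G] + [Im F, Re G]; the four real brackets are tangent.\<close>

lemma lie_bracket_in_ctangent_space:
  assumes M: "submanifold \<kappa> d M" "order_at_least 2 \<kappa>" "p \<in> M" and N: "open N" "p \<in> N"
    and d: "F differentiable (at p)" "G differentiable (at p)"
    and t: "\<And>q. q \<in> M \<inter> N \<Longrightarrow> F q \<in> ctangent_space M q" "\<And>q. q \<in> M \<inter> N \<Longrightarrow> G q \<in> ctangent_space M q"
  shows "lie_bracket UNIV F G p \<in> ctangent_space M p"
proof -
  define F' where "F' = frechet_derivative F (at p)"
  define G' where "G' = frechet_derivative G (at p)"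
  have F': "(F has_derivative F') (at p)" and G': "(G has_derivative G') (at p)"
    using d by (auto simp: F'_def G'_def frechet_derivative_works)
  note tF = t(1)[unfolded ctangent_space_def mem_Times_iff]
  note tG = t(2)[unfolded ctangent_space_def mem_Times_iff]
  note sub = subspace_tangent_space(1)[OF M]
  have "fst (G' (fst (F p))) - fst (F' (fst (G p))) \<in> tangent_space M p"
    using real_bracket_tangent[OF M N has_derivative_fst[OF F'] _ has_derivative_fst[OF G']] tF tG by blast
  moreover have "snd (G' (snd (F p))) - snd (F' (snd (G p))) \<in> tangent_space M p"
    using real_bracket_tangent[OF M N has_derivative_snd[OF F'] _ has_derivative_snd[OF G']] tF tG by blast
  moreover have "snd (G' (fst (F p))) - fst (F' (snd (G p))) \<in> tangent_space M p"
    using real_bracket_tangent[OF M N has_derivative_fst[OF F'] _ has_derivative_snd[OF G']] tF tG by blast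
  moreover have "fst (G' (snd (F p))) - snd (F' (fst (G p))) \<in> tangent_space M p"
    using real_bracket_tangent[OF M N has_derivative_snd[OF F'] _ has_derivative_fst[OF G']] tF tG by blast
  ultimately have
    "(fst (G' (fst (F p))) - fst (F' (fst (G p)))) - (snd (G' (snd (F p))) - snd (F' (snd (G p)))) \<in> tangent_space M p"
    "(snd (G' (fst (F p))) - fst (F' (snd (G p)))) + (fst (G' (snd (F p))) - snd (F' (fst (G p)))) \<in> tangent_space M p"
    using sub by (auto intro: subspace_diff subspace_add)
  then show ?thesis
    unfolding lie_bracket_def covariant_has_derivative[OF F'] covariant_has_derivative[OF G']
    by (simp add: ctangent_space_def cscale_def mem_Times_iff algebra_simps)
qed

lemma ctangent_space_cscale:
  assumes "submanifold \<kappa> d M" "order_at_least 2 \<kappa>" "p \<in> M" "X \<in> ctangent_space M p"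
  shows "c *\<^sub>C X \<in> ctangent_space M p"
  using subspace_tangent_space(1)[OF assms(1-3)] assms(4)
  by (auto simp: ctangent_space_def cscale_def mem_Times_iff
      intro!: subspace_diff subspace_add subspace_scale)

lemma ctangent_space_cconj:
  assumes "submanifold \<kappa> d M" "order_at_least 2 \<kappa>" "p \<in> M" "X \<in> ctangent_space M p"
  shows "cconj X \<in> ctangent_space M p"
  using subspace_tangent_space(1)[OF assms(1-3)] assms(4)
  by (auto simp: ctangent_space_def cconj_def mem_Times_iff intro!: subspace_neg)

section \<open>Complex rank of the (1,0) bundle\<close>

lemma linear_J: "linear J"
  by (rule linearI) (auto simp: J_def vec_eq_iff algebra_simps scaleR_conv_of_real)

lemma J_J: "J (J v) = - v"
  by (simp add: J_def vec_eq_iff)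

text \<open>The maximal complex subspace of a tangent space has real dimension \<open>4 + 4 - 6 = 2\<close>.\<close>

lemma T10_rank_one:
  fixes M :: "(complex ^ 3) set"
  assumes M: "submanifold \<kappa> 4 M" "order_at_least 2 \<kappa>" "CR_generic M" "p \<in> M"
    and X: "X \<in> T10 M p" "X \<noteq> 0" and Y: "Y \<in> T10 M p"
  obtains c where "Y = c *\<^sub>C X" "fst Y = c *s fst X" "fst X \<noteq> 0"
proof -
  let ?T = "tangent_space M p"
  note T = subspace_tangent_space[OF M(1,2,4)]
  define H where "H = ?T \<inter> J ` ?T"
  have inj: "inj J" by (rule injI) (metis J_J minus_equation_iff)
  have JT: "subspace (J ` ?T)" "dim (J ` ?T) = 4"
    using linear_subspace_image[OF linear_J T(1)] dim_image_eq[OF linear_J, of ?T] inj T(2)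
    by (auto intro: inj_on_subset)
  \<comment> \<open>Genericity says that the sum of the tangent space and its image under
    \<open>J\<close> is everything, of real dimension 6; the dimension formula then yields that of
    \<open>H\<close>.\<close>
  have "{x + y |x y. x \<in> ?T \<and> y \<in> J ` ?T} = UNIV"
  proof -
    have "{x + y |x y. x \<in> ?T \<and> y \<in> J ` ?T} = {u + J v |u v. u \<in> ?T \<and> v \<in> ?T}" by blast
    then show ?thesis using M(3,4) unfolding CR_generic_def by simp
  qed
  then have "dim (UNIV :: (complex ^ 3) set) + dim H = 8"
    using dim_sums_Int[OF T(1) JT(1)] T(2) JT(2) by (simp add: H_def)
  then have H: "dim H = 2" by (simp add: dim_UNIV)
  \<comment> \<open>The eigenvalue equation turns \<open>Z\<close> into u - \<i> J u with u =
    \<open>fst Z\<close>, so both u and J u are tangent.\<close>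
  have T10D: "fst Z \<in> ?T" "J (fst Z) \<in> ?T" "snd Z = - J (fst Z)" "fst Z \<in> H" if "Z \<in> T10 M p" for Z
  proof -
    have Z: "fst Z \<in> ?T" "snd Z \<in> ?T" "J (fst Z) = - snd Z" "J (snd Z) = fst Z"
      using that by (auto simp: T10_def ctangent_space_def cscale_def mem_Times_iff)
    then show "fst Z \<in> ?T" "J (fst Z) \<in> ?T" "snd Z = - J (fst Z)" "fst Z \<in> H"
      using subspace_neg[OF T(1)] by (auto simp: H_def) (metis imageI)
  qed
  define u where "u = fst X"
  have u: "u \<noteq> 0"
    using T10D(3)[OF X(1)] X(2) linear_0[OF linear_J] by (auto simp: u_def prod_eq_iff)
  have uH: "u \<in> H" "J u \<in> H" using T10D[OF X(1)] by (auto simp: u_def H_def)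
  \<comment> \<open>\<open>J\<close> has no real eigenvalue, so u and J u are independent over the
    reals and span \<open>H\<close>.\<close>
  have ne: "J u \<noteq> k *\<^sub>R u" for k
  proof
    assume *: "J u = k *\<^sub>R u"
    have "(\<i> - of_real k) * u $ j = 0" for j
    proof -
      have "\<i> * u $ j = k *\<^sub>R (u $ j)" using arg_cong[OF *, of "\<lambda>v. v $ j"] by (simp add: J_def)
      then show ?thesis by (simp add: scaleR_conv_of_real left_diff_distrib)
    qed
    moreover have "\<i> - of_real k \<noteq> 0" by (simp add: complex_eq_iff)
    ultimately have "u = 0" by (simp add: vec_eq_iff)
    with u show False ..
  qed
  have ind: "independent {J u, u}" "J u \<noteq> u"
    using ne u ne[of 1] by (auto simp: independent_insert span_singleton)
  have "H \<subseteq> span {J u, u}"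
    by (rule card_ge_dim_independent) (use ind uH H in auto)
  then have "fst Y \<in> span {J u, u}" using T10D(4)[OF Y] by auto
  then obtain x y where xy: "fst Y = y *\<^sub>R J u + x *\<^sub>R u"
    by (auto simp: span_insert span_singleton algebra_simps)
  have sY: "snd Y = y *\<^sub>R u - x *\<^sub>R J u" and sX: "snd X = - J u"
    using T10D(3)[OF Y] T10D(3)[OF X(1)]
    by (simp_all add: xy u_def linear_add[OF linear_J] linear_cmul[OF linear_J] J_J)
  show thesis
  \<comment> \<open>\<open>J\<close> is multiplication by \<i> on the ambient space, so x u + y J u
    is (x + \<i> y) u.\<close>
  proof (rule that[of "Complex x y"])
    show "Y = Complex x y *\<^sub>C X"
      using xy sY sX by (simp add: prod_eq_iff cscale_def u_def)
    show "fst Y = Complex x y *s fst X"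
      unfolding xy by (simp add: u_def[symmetric] vec_eq_iff J_def complex_eq_iff)
    show "fst X \<noteq> 0" using u by (simp add: u_def)
  qed
qed

section \<open>Dimension count for frames\<close>

text \<open>A basis chosen inside \<open>S\<close> has d elements, at least as many as
  \<open>S\<close>, hence is all of \<open>S\<close>. A real basis of the tangent space also spans
  the complexification over the complex numbers, so no independent set there has more than d
  elements and \<open>S\<close> cannot be enlarged.\<close>

lemma cplx_independent_span_ctangent:
  fixes M :: "'a::euclidean_space set"
  assumes M: "submanifold \<kappa> d M" "order_at_least 2 \<kappa>" "p \<in> M"
    and S: "finite S" "card S \<le> d" "cplx.dim S = d" "S \<subseteq> ctangent_space M p"
  shows "cplx.independent S" "card S = d" "cplx.span S = ctangent_space M p"
proof -
  obtain B where B: "B \<subseteq> S" "cplx.independent B" "S \<subseteq> cplx.span B" "card B = cplx.dim S"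
    using cplx.basis_exists by blast
  have "B = S" using B S by (intro card_subset_eq) (auto dest: card_mono)
  then show ind: "cplx.independent S" and card: "card S = d" using B S by auto
  obtain R where R: "R \<subseteq> tangent_space M p" "independent R" "tangent_space M p \<subseteq> span R" "card R = d"
    using basis_exists[of "tangent_space M p"] subspace_tangent_space(2)[OF M] by metis
  have finR: "finite R" using R(2) by (rule independent_imp_finite)
  let ?R = "(\<lambda>b. (b, 0 :: 'a)) ` R"
  have sp: "(u, 0) \<in> cplx.span ?R" if "u \<in> span R" for u
    using that
  proof (induction rule: span_induct_alt)
    case base
    then show ?case using cplx.span_zero[of ?R] by (simp add: zero_prod_def)
  next
    case (step c b v)
    have eq: "of_real c *\<^sub>C (b, 0) + (v, 0) = (c *\<^sub>R b + v, 0)" by (simp add: cscale_def)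
    have "of_real c *\<^sub>C (b, 0) + (v, 0) \<in> cplx.span ?R"
      using step by (intro cplx.span_add[OF cplx.span_scale[OF cplx.span_base]]) auto
    then show ?case unfolding eq .
  qed
  have ct: "ctangent_space M p \<subseteq> cplx.span ?R"
  proof
    fix X assume "X \<in> ctangent_space M p"
    moreover have eq: "(fst X, 0) + \<i> *\<^sub>C (snd X, 0) = X" by (simp add: cscale_def)
    ultimately have "(fst X, 0) + \<i> *\<^sub>C (snd X, 0) \<in> cplx.span ?R"
      using R(3) by (intro cplx.span_add cplx.span_scale sp) (auto simp: ctangent_space_def mem_Times_iff)
    then show "X \<in> cplx.span ?R" unfolding eq .
  qed
  have "cplx.subspace (ctangent_space M p)"
    using subspace_tangent_space(1)[OF M] ctangent_space_cscale[OF M]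
    by (intro cplx.subspaceI)
      (auto simp: ctangent_space_def mem_Times_iff subspace_0 zero_prod_def intro: subspace_add)
  then have "cplx.span S \<subseteq> ctangent_space M p" using S(4) by (intro cplx.span_minimal)
  moreover have "X \<in> cplx.span S" if "X \<in> ctangent_space M p" for X
  proof (rule ccontr)
    \<comment> \<open>A vector outside the span would give d + 1 independent elements in the span of
      the d generators \<open>?R\<close>.\<close>
    assume X: "X \<notin> cplx.span S"
    then have "cplx.independent (insert X S)" "X \<notin> S"
      using ind by (auto simp: cplx.independent_insert intro: cplx.span_base)
    moreover have "insert X S \<subseteq> cplx.span ?R" using ct that S(4) by auto
    ultimately have "card (insert X S) \<le> card ?R"
      using cplx.independent_span_bound[of ?R "insert X S"] finR by auto
    also have "\<dots> \<le> card R" by (rule card_image_le[OF finR])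
    finally show False using R(4) card S(1) \<open>X \<notin> S\<close> by simp
  qed
  ultimately show "cplx.span S = ctangent_space M p" by auto
qed

section \<open>The structure group\<close>

lemma vector_4 [simp]:
  "(vector [x, y, z, w] :: 'a::zero ^ 4) $ 1 = x"
  "(vector [x, y, z, w] :: 'a::zero ^ 4) $ 2 = y"
  "(vector [x, y, z, w] :: 'a::zero ^ 4) $ 3 = z"
  "(vector [x, y, z, w] :: 'a::zero ^ 4) $ 4 = w"
  unfolding vector_def by simp_all

text \<open>Five entries are free and the other eleven are determined by polynomial equations in
  them and their conjugates. Products, closedness and the flattening are read off from this
  form.\<close>

lemma G_II_initial_iff:
  "A \<in> G_II_initial \<longleftrightarrow> A $ 1 $ 1 \<noteq> 0 \<and> A $ 1 $ 2 = 0 \<and> A $ 1 $ 3 = 0 \<and> A $ 1 $ 4 = 0 \<and>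
    A $ 2 $ 1 = 0 \<and> A $ 2 $ 2 = cnj (A $ 1 $ 1) \<and> A $ 2 $ 3 = 0 \<and> A $ 2 $ 4 = 0 \<and>
    A $ 3 $ 2 = cnj (A $ 3 $ 1) \<and> A $ 3 $ 3 = A $ 1 $ 1 * cnj (A $ 1 $ 1) \<and> A $ 3 $ 4 = 0 \<and>
    A $ 4 $ 4 = A $ 1 $ 1 * A $ 1 $ 1 * cnj (A $ 1 $ 1)" (is "_ \<longleftrightarrow> ?R")
proof
  show "A \<in> G_II_initial \<Longrightarrow> ?R" by (auto simp: G_II_initial_def)
  assume ?R
  then show "A \<in> G_II_initial"
    unfolding G_II_initial_def
    by (intro CollectI exI[of _ "A $ 1 $ 1"] exI[of _ "A $ 3 $ 1"] exI[of _ "A $ 4 $ 3"]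
        exI[of _ "A $ 4 $ 2"] exI[of _ "A $ 4 $ 1"]) (simp add: vec_eq_iff forall_4)
qed

text \<open>Entries (3,1) and (3,2) of a product stay conjugate because the diagonal entry a cnj a
  is real.\<close>

lemma G_II_initial_mult: "A \<in> G_II_initial \<Longrightarrow> B \<in> G_II_initial \<Longrightarrow> A ** B \<in> G_II_initial"
  by (simp add: G_II_initial_iff matrix_matrix_mult_def sum_4 algebra_simps)

lemma G_II_initial_inverse:
  assumes "A \<in> G_II_initial"
  obtains B where "B \<in> G_II_initial" "A ** B = mat 1" "B ** A = mat 1"
proof -
  define a b c d e where "a = A $ 1 $ 1" "b = A $ 3 $ 1" "c = A $ 4 $ 3" "d = A $ 4 $ 2" "e = A $ 4 $ 1"
  define n where "n = a * a * cnj a"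
  \<comment> \<open>Forward substitution in a lower triangular matrix: b / a + a cnj a b' = 0. The
    divisor a (a cnj a) happens to equal the last diagonal entry \<open>n\<close>.\<close>
  define b' where "b' = - b / n"
  define B :: "complex ^ 4 ^ 4" where "B =
    vector [vector [1 / a, 0, 0, 0],
            vector [0, 1 / cnj a, 0, 0],
            vector [b', cnj b', 1 / (a * cnj a), 0],
            vector [- (e / a + c * b') / n, - (d / cnj a + c * cnj b') / n, - c / (a * cnj a * n), 1 / n]]"
  have a: "a \<noteq> 0" using assms by (simp add: G_II_initial_iff a_b_c_d_e_def)
  then have n: "n \<noteq> 0" by (simp add: n_def)
  have A: "A = vector [vector [a, 0, 0, 0], vector [0, cnj a, 0, 0],
      vector [b, cnj b, a * cnj a, 0], vector [e, d, c, n]]"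
    using assms by (simp add: G_II_initial_iff vec_eq_iff forall_4 a_b_c_d_e_def n_def)
  have "B \<in> G_II_initial"
    using a by (simp add: G_II_initial_iff B_def n_def)
  moreover have "A ** B = mat 1"
    unfolding A B_def
    using a by (simp add: vec_eq_iff forall_4 matrix_matrix_mult_def sum_4 mat_def b'_def n_def field_simps)
  ultimately show thesis using that matrix_left_right_inverse by blast
qed

lemma G_II_initial_subset_GL: "G_II_initial \<subseteq> carrier GL"
  by (auto simp: GL_def invertible_def elim: G_II_initial_inverse)

lemma group_GL: "Group.group GL"
proof (rule Group.groupI)
  show "\<exists>y\<in>carrier GL. y \<otimes>\<^bsub>GL\<^esub> x = \<one>\<^bsub>GL\<^esub>" if "x \<in> carrier GL" for x
    using that by (auto simp: GL_def invertible_def)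
  show "\<one>\<^bsub>GL\<^esub> \<in> carrier GL" by (auto simp: GL_def invertible_def intro: exI[of _ "mat 1"])
qed (simp_all add: GL_def invertible_mult matrix_mul_assoc)

lemma subgroup_G_II_initial: "subgroup G_II_initial GL"
proof
  show "G_II_initial \<subseteq> carrier GL" by (rule G_II_initial_subset_GL)
  show "x \<otimes>\<^bsub>GL\<^esub> y \<in> G_II_initial" if "x \<in> G_II_initial" "y \<in> G_II_initial" for x y
    using G_II_initial_mult[OF that] by (simp add: GL_def)
  show "\<one>\<^bsub>GL\<^esub> \<in> G_II_initial" by (simp add: GL_def G_II_initial_iff mat_def)
  fix x assume x: "x \<in> G_II_initial"
  then obtain y where y: "y \<in> G_II_initial" "x ** y = mat 1" "y ** x = mat 1"
    by (rule G_II_initial_inverse)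
  then have "inv\<^bsub>GL\<^esub> x = y"
    using x G_II_initial_subset_GL by (intro Group.group.inv_equality[OF group_GL]) (auto simp: GL_def)
  with y show "inv\<^bsub>GL\<^esub> x \<in> G_II_initial" by simp
qed

text \<open>The equations cut out a closed set of matrices; the open condition a \<noteq> 0 comes
  for free within \<open>GL\<close>, since a = 0 would make the first row vanish.\<close>

lemma closedin_G_II_initial: "closedin (top_of_set (carrier GL)) G_II_initial"
proof -
  define C where "C = {A :: complex ^ 4 ^ 4. A $ 1 $ 2 = 0 \<and> A $ 1 $ 3 = 0 \<and> A $ 1 $ 4 = 0 \<and>
    A $ 2 $ 1 = 0 \<and> A $ 2 $ 2 = cnj (A $ 1 $ 1) \<and> A $ 2 $ 3 = 0 \<and> A $ 2 $ 4 = 0 \<and>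
    A $ 3 $ 2 = cnj (A $ 3 $ 1) \<and> A $ 3 $ 3 = A $ 1 $ 1 * cnj (A $ 1 $ 1) \<and> A $ 3 $ 4 = 0 \<and>
    A $ 4 $ 4 = A $ 1 $ 1 * A $ 1 $ 1 * cnj (A $ 1 $ 1)}"
  have "closed C"
    unfolding C_def by (intro closed_Collect_conj closed_Collect_eq continuous_intros)
  moreover have "A $ 1 $ 1 \<noteq> 0" if "A \<in> carrier GL" "A \<in> C" for A
  proof
    assume "A $ 1 $ 1 = 0"
    have "\<exists>B. A ** B = mat 1" using that(1) by (auto simp: GL_def invertible_def)
    then obtain B where "A ** B = mat 1" ..
    then have "(A ** B) $ 1 $ 1 = 1" by (simp add: mat_def)
    then show False
      using \<open>A $ 1 $ 1 = 0\<close> that(2) by (simp add: C_def matrix_matrix_mult_def sum_4)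
  qed
  then have "G_II_initial = carrier GL \<inter> C"
    using G_II_initial_subset_GL by (auto simp: G_II_initial_iff C_def)
  ultimately show ?thesis unfolding closedin_closed by blast
qed

text \<open>Subtracting the non-linear diagonal entries \<open>a * cnj a\<close> and \<open>a * a * cnj a\<close> is a polynomial
  diffeomorphism that flattens the group onto a real linear subspace.\<close>

lemma submanifold_G_II_initial: "submanifold Cinf 10 G_II_initial"
proof -
  define P :: "4 \<Rightarrow> complex \<Rightarrow> complex ^ 4 ^ 4" where
    "P k c = (\<chi> i j. if i = k \<and> j = k then c else 0)" for k c
  \<comment> \<open>\<open>N A\<close> depends on the entry (1,1) only and is zero there. Adding and
    subtracting it are therefore mutually inverse shears, and both preserve
    \<open>U\<close>.\<close>
  define N where "N A = P 3 (A $ 1 $ 1 * cnj (A $ 1 $ 1)) + P 4 (A $ 1 $ 1 * A $ 1 $ 1 * cnj (A $ 1 $ 1))"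
    for A :: "complex ^ 4 ^ 4"
  define U where "U = {A :: complex ^ 4 ^ 4. A $ 1 $ 1 \<noteq> 0}"
  \<comment> \<open>Linear parametrisation of the flattened group by five complex numbers, hence of
    real dimension 10; linearity is over the reals because of the conjugates.\<close>
  define h :: "complex \<times> complex \<times> complex \<times> complex \<times> complex \<Rightarrow> complex ^ 4 ^ 4" where
    "h = (\<lambda>(a, b, c, d, e). vector [vector [a, 0, 0, 0], vector [0, cnj a, 0, 0],
      vector [b, cnj b, 0, 0], vector [e, d, c, 0]])"
  have U: "open U" unfolding U_def by (intro open_Collect_neq continuous_intros)
  have P: "bounded_linear (P k)" for k
    unfolding linear_conv_bounded_linear[symmetric]
    by (rule linearI) (auto simp: P_def vec_eq_iff)
  have N11: "N A $ 1 $ 1 = 0" for A by (simp add: N_def P_def)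
  have NN: "N (A + N A) = N A" "N (A - N A) = N A" for A
    by (simp_all add: N_def[of "_ + _"] N_def[of "_ - _"] N11) (simp_all add: N_def)
  have ckN: "ck_on k U N" for k
  proof -
    have e: "ck_on k U (\<lambda>A. A $ 1 $ 1)"
      by (intro ck_on_linear_id U bounded_linear_vec_nth[THEN bounded_linear_compose] bounded_linear_vec_nth)
    have c: "ck_on k U (\<lambda>A. cnj (A $ 1 $ 1))"
      by (rule ck_on_bounded_linear[OF bounded_linear_cnj U e])
    show ?thesis unfolding N_def[abs_def]
      by (intro ck_on_add[OF U] ck_on_bounded_linear[OF P U] ck_on_bilinear[OF bounded_bilinear_mult U] e c)
  qed
  have \<Phi>: "ck_on k U (\<lambda>A. A + - N A)" and \<Psi>: "ck_on k U (\<lambda>A. A + N A)" for k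
    by (intro ck_on_add[OF U] ck_on_linear_id[OF bounded_linear_ident U] ckN
        ck_on_bounded_linear[OF bounded_linear_minus[OF bounded_linear_ident] U])+
  have lin: "linear h"
    by (rule linearI) (auto simp: h_def vec_eq_iff forall_4)
  have inj: "inj h"
    by (auto simp: inj_def h_def vec_eq_iff forall_4)
  have "dim (range h) = dim (UNIV :: (complex \<times> complex \<times> complex \<times> complex \<times> complex) set)"
    using inj by (intro dim_image_eq[OF lin]) auto
  then have dim: "dim (range h) = 10" by (simp add: dim_UNIV)
  have range: "A \<in> range h \<longleftrightarrow> A $ 1 $ 2 = 0 \<and> A $ 1 $ 3 = 0 \<and> A $ 1 $ 4 = 0 \<and>
    A $ 2 $ 1 = 0 \<and> A $ 2 $ 2 = cnj (A $ 1 $ 1) \<and> A $ 2 $ 3 = 0 \<and> A $ 2 $ 4 = 0 \<and>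
    A $ 3 $ 2 = cnj (A $ 3 $ 1) \<and> A $ 3 $ 3 = 0 \<and> A $ 3 $ 4 = 0 \<and> A $ 4 $ 4 = 0" (is "_ \<longleftrightarrow> ?R") for A
  proof
    show "A \<in> range h \<Longrightarrow> ?R" by (auto simp: h_def)
    assume ?R
    then have "A = h (A $ 1 $ 1, A $ 3 $ 1, A $ 4 $ 3, A $ 4 $ 2, A $ 4 $ 1)"
      by (simp add: h_def vec_eq_iff forall_4)
    then show "A \<in> range h" by blast
  qed
  have G: "A \<in> G_II_initial \<longleftrightarrow> A \<in> U \<and> A + - N A \<in> range h" for A
    unfolding G_II_initial_iff range by (auto simp: U_def N_def P_def)
  have inU: "A + - N A \<in> U \<longleftrightarrow> A \<in> U" "A + N A \<in> U \<longleftrightarrow> A \<in> U" for A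
    by (simp_all add: U_def N11)
  have inv: "(A + - N A) + N (A + - N A) = A" "(A + N A) + - N (A + N A) = A" for A
    using NN by simp_all
  show ?thesis
    unfolding submanifold_def
  proof (intro ballI exI conjI)
    fix A assume "A \<in> G_II_initial"
    then show "A \<in> U" using G by blast
    show "open U" "open U" by (fact U)+
    have "continuous_on U (\<lambda>A. A + - N A)" "continuous_on U (\<lambda>A. A + N A)"
      using \<Phi>[of 0] \<Psi>[of 0] by simp_all
    then show "homeomorphism U U (\<lambda>A. A + - N A) (\<lambda>A. A + N A)"
      using inU inv by (intro homeomorphismI) auto
    show "class_on Cinf U (\<lambda>A. A + - N A)" "class_on Cinf U (\<lambda>A. A + N A)"
      using \<Phi> \<Psi> by (simp_all add: class_on_def)
    show "subspace (range h)" by (rule linear_subspace_image[OF lin subspace_UNIV])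
    show "dim (range h) = 10" by (rule dim)
    show "(\<lambda>A. A + - N A) ` (U \<inter> G_II_initial) = U \<inter> range h"
    proof (intro equalityI subsetI)
      fix B assume "B \<in> U \<inter> range h"
      then have "B + N B \<in> U \<inter> G_II_initial" "B = (B + N B) + - N (B + N B)"
        using G inU inv by simp_all
      then show "B \<in> (\<lambda>A. A + - N A) ` (U \<inter> G_II_initial)" by blast
    qed (use G inU in auto)
  qed
qed

section \<open>Frames\<close>

lemma ck_on_cdir:
  fixes h :: "'a::euclidean_space \<Rightarrow> complex"
  assumes U: "open U" and h: "ck_on (Suc k) U h" and X: "ck_on k U X"
  shows "ck_on k U (\<lambda>q. cdir h q (X q))"
proof -
  have *: "ck_on k U (\<lambda>q. frechet_derivative h (at q) (Z q))" if "ck_on k U Z" for Z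
    using class_on_derivative_along[OF U, of "Ck (Suc k)" h Z] h that by (simp add: class_on_def del: ck_on.simps)
  show ?thesis unfolding cdir_def
    by (intro ck_on_add[OF U] ck_on_bounded_linear[OF bounded_linear_mult_right U] *
        ck_on_bounded_linear[OF bounded_linear_fst U X] ck_on_bounded_linear[OF bounded_linear_snd U X])
qed

lemma cdir_const: "cdir (\<lambda>q. c) p X = 0"
  by (simp add: cdir_def)

lemma lie_bracket_const_cscale_right:
  fixes X Y :: "'a::euclidean_space \<Rightarrow> 'a \<times> 'a"
  assumes "X differentiable (at p)" "Y differentiable (at p)"
  shows "lie_bracket UNIV X (\<lambda>q. c *\<^sub>C Y q) p = c *\<^sub>C lie_bracket UNIV X Y p"
  using lie_bracket_cscale[of "\<lambda>_. 1" p "\<lambda>_. c", OF _ _ assms] by (simp add: cdir_const)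

lemma ck_on_lie_bracket:
  fixes X Y :: "'a::euclidean_space \<Rightarrow> 'a \<times> 'a"
  assumes "open U" "ck_on (Suc k) U X" "ck_on (Suc k) U Y"
  shows "ck_on k U (lie_bracket UNIV X Y)"
  using class_on_lie_bracket[of U "Ck (Suc k)" Y X] assms by (simp add: class_on_def del: ck_on.simps)

text \<open>Under \<open>L' = a L\<close> the bracket \<open>\<i> [L, cnj L]\<close> picks up the coefficient
  \<open>b = - \<i> cnj a (cnj L)(a)\<close>, and the coefficient \<open>\<i> a L(cnj a)\<close> of \<open>cnj L\<close> is its conjugate.\<close>

lemma frame_change:
  fixes F :: "'a::euclidean_space \<Rightarrow> 'a \<times> 'a"
  assumes U: "open U" "p \<in> U" and F: "ck_on 2 U F" and a: "ck_on 2 U a"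
  defines "T \<equiv> \<lambda>q. \<i> *\<^sub>C lie_bracket UNIV F (\<lambda>q. cconj (F q)) q"
    and "T' \<equiv> \<lambda>q. \<i> *\<^sub>C lie_bracket UNIV (\<lambda>q. a q *\<^sub>C F q) (\<lambda>q. cconj (a q *\<^sub>C F q)) q"
  obtains b c d e where
    "T' p = b *\<^sub>C F p + cnj b *\<^sub>C cconj (F p) + (a p * cnj (a p)) *\<^sub>C T p"
    "lie_bracket UNIV (\<lambda>q. a q *\<^sub>C F q) T' p =
      e *\<^sub>C F p + d *\<^sub>C cconj (F p) + c *\<^sub>C T p + (a p * a p * cnj (a p)) *\<^sub>C lie_bracket UNIV F T p"
proof -
  have F2: "ck_on (Suc (Suc 0)) U F" and a2: "ck_on (Suc (Suc 0)) U a"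
    using F a by (simp_all add: numeral_2_eq_2)
  define \<beta> where "\<beta> q = (- \<i>) * (cnj (a q) * cdir a q (cconj (F q)))" for q
  define \<alpha> where "\<alpha> q = a q * cnj (a q)" for q
  define Fb where "Fb q = cconj (F q)" for q
  have Fb2: "ck_on (Suc (Suc 0)) U Fb"
    unfolding Fb_def[abs_def] by (rule ck_on_bounded_linear[OF bounded_linear_cconj U(1) F2])
  have ab2: "ck_on (Suc (Suc 0)) U (\<lambda>q. cnj (a q))"
    by (rule ck_on_bounded_linear[OF bounded_linear_cnj U(1) a2])
  \<comment> \<open>T, \<alpha> and \<beta> use at most one derivative of C^2 data, so the bracket
    with a L may differentiate them once more.\<close>
  have T1: "ck_on (Suc 0) U T"
    unfolding T_def Fb_def[abs_def, symmetric]
    by (intro ck_on_bounded_linear[OF bounded_linear_cscale_right U(1)] ck_on_lie_bracket U(1) F2 Fb2)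
  have \<alpha>1: "ck_on (Suc 0) U \<alpha>"
    unfolding \<alpha>_def[abs_def]
    by (intro ck_on_bilinear[OF bounded_bilinear_mult U(1)] ck_on_SucD[OF a2] ck_on_SucD[OF ab2])
  have \<beta>1: "ck_on (Suc 0) U \<beta>"
    unfolding \<beta>_def[abs_def] Fb_def[symmetric]
    by (intro ck_on_bounded_linear[OF bounded_linear_mult_right U(1)] ck_on_bilinear[OF bounded_bilinear_mult U(1)]
        ck_on_cdir[OF U(1) a2] ck_on_SucD[OF ab2] ck_on_SucD[OF Fb2])
  have \<beta>b1: "ck_on (Suc 0) U (\<lambda>q. cnj (\<beta> q))"
    by (rule ck_on_bounded_linear[OF bounded_linear_cnj U(1) \<beta>1])
  have dif: "F differentiable (at q)" "Fb differentiable (at q)" "a differentiable (at q)"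
    "(\<lambda>q. cnj (a q)) differentiable (at q)" "T differentiable (at q)" "\<alpha> differentiable (at q)"
    "\<beta> differentiable (at q)" "(\<lambda>q. cnj (\<beta> q)) differentiable (at q)" if "q \<in> U" for q
    using that F2 Fb2 a2 ab2 T1 \<alpha>1 \<beta>1 \<beta>b1 by (auto intro: ck_on_differentiable simp del: ck_on.simps)
  have difs: "(\<lambda>q. s q *\<^sub>C Z q) differentiable (at q)"
    if "s differentiable (at q)" "Z differentiable (at q)" for s q and Z :: "'a \<Rightarrow> 'a \<times> 'a"
    using that bounded_bilinear.FDERIV[OF bounded_bilinear_cscale] unfolding differentiable_def by blast
  have B: "lie_bracket UNIV F Fb q = (- \<i>) *\<^sub>C T q" for q
    by (simp add: T_def Fb_def[abs_def])
  \<comment> \<open>Required on all of \<open>U\<close> and not only at \<open>p\<close>, because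
    the next bracket differentiates \<open>T'\<close>.\<close>
  have T': "T' q = \<beta> q *\<^sub>C F q + cnj (\<beta> q) *\<^sub>C Fb q + \<alpha> q *\<^sub>C T q" if q: "q \<in> U" for q
  proof -
    have "T' q = \<i> *\<^sub>C lie_bracket UNIV (\<lambda>q. a q *\<^sub>C F q) (\<lambda>q. cnj (a q) *\<^sub>C Fb q) q"
      by (simp add: T'_def cconj_cscale Fb_def)
    also have "\<dots> = \<i> *\<^sub>C ((a q * cnj (a q)) *\<^sub>C lie_bracket UNIV F Fb q +
        (a q * cdir (\<lambda>q. cnj (a q)) q (F q)) *\<^sub>C Fb q - (cnj (a q) * cdir a q (Fb q)) *\<^sub>C F q)"
      using dif[OF q] by (subst lie_bracket_cscale) simp_all
    also have "cdir (\<lambda>q. cnj (a q)) q (F q) = cnj (cdir a q (Fb q))"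
      by (simp add: cdir_cnj dif[OF q] Fb_def)
    finally show ?thesis
      by (simp add: B \<alpha>_def \<beta>_def Fb_def[symmetric] cplx.scale_right_distrib cplx.scale_right_diff_distrib
          mult_ac cplx.scale_minus_left)
  qed
  let ?aF = "\<lambda>q. a q *\<^sub>C F q"
  have daF: "?aF differentiable (at p)" using dif[OF U(2)] by (intro difs)
  have "lie_bracket UNIV ?aF T' p =
      lie_bracket UNIV ?aF (\<lambda>q. \<beta> q *\<^sub>C F q + cnj (\<beta> q) *\<^sub>C Fb q + \<alpha> q *\<^sub>C T q) p"
    using T' by (intro lie_bracket_cong_open[OF U, symmetric])
      (auto intro!: daF differentiable_add difs dif[OF U(2)])
  also have "\<dots> = lie_bracket UNIV ?aF (\<lambda>q. \<beta> q *\<^sub>C F q) p +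
      lie_bracket UNIV ?aF (\<lambda>q. cnj (\<beta> q) *\<^sub>C Fb q) p + lie_bracket UNIV ?aF (\<lambda>q. \<alpha> q *\<^sub>C T q) p"
    by ((subst lie_bracket_add_right; (intro daF differentiable_add difs dif[OF U(2)])?)+, rule refl)
  \<comment> \<open>[F, F] = 0 leaves only F terms from the first summand, and [F, cnj F] = - \<i> T
    adds a T term coming from the second.\<close>
  also have "\<dots> = ((a p * \<beta> p) *\<^sub>C 0 + (a p * cdir \<beta> p (F p)) *\<^sub>C F p - (\<beta> p * cdir a p (F p)) *\<^sub>C F p) +
      ((a p * cnj (\<beta> p)) *\<^sub>C ((- \<i>) *\<^sub>C T p) + (a p * cdir (\<lambda>q. cnj (\<beta> q)) p (F p)) *\<^sub>C Fb p -
        (cnj (\<beta> p) * cdir a p (Fb p)) *\<^sub>C F p) +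
      ((a p * \<alpha> p) *\<^sub>C lie_bracket UNIV F T p + (a p * cdir \<alpha> p (F p)) *\<^sub>C T p - (\<alpha> p * cdir a p (T p)) *\<^sub>C F p)"
    using dif[OF U(2)] by (simp add: lie_bracket_cscale lie_bracket_self B)
  also have "\<dots> = (a p * cdir \<beta> p (F p) - \<beta> p * cdir a p (F p) - cnj (\<beta> p) * cdir a p (Fb p) -
        \<alpha> p * cdir a p (T p)) *\<^sub>C F p + (a p * cdir (\<lambda>q. cnj (\<beta> q)) p (F p)) *\<^sub>C Fb p +
      (a p * cdir \<alpha> p (F p) - \<i> * a p * cnj (\<beta> p)) *\<^sub>C T p + (a p * a p * cnj (a p)) *\<^sub>C lie_bracket UNIV F T p"
    by (simp add: \<alpha>_def cplx.scale_left_distrib cplx.scale_left_diff_distrib mult_ac)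
  finally show thesis
    using that T'[OF U(2)] unfolding Fb_def \<alpha>_def by blast
qed

section \<open>Frames of a submanifold through ambient extensions\<close>

text \<open>The constant \<open>c\<close> is \<i> for the field S and 1 for the iterated bracket of
  \<open>general_class_II\<close>. The class \<mu> is independent of that of \<open>M\<close>: it is
  \<kappa> - 1 for the smoothness of a frame, but C^2 suffices to compare two frames at a
  point.\<close>

lemma bracket_extension:
  fixes M :: "'a::euclidean_space set"
  assumes M: "submanifold \<kappa> d M" "order_at_least 2 \<kappa>" and U: "open U"
    and F: "class_on \<mu> U F" "order_at_least 2 \<mu>"
    and L: "\<forall>q\<in>M \<inter> U. F q = L q" "\<forall>q\<in>M \<inter> U. L q \<in> ctangent_space M q"
  defines "B \<equiv> lie_bracket UNIV F (\<lambda>q. cconj (F q))"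
    and "B' \<equiv> lie_bracket M L (\<lambda>q. cconj (L q))"
  shows "class_on (drop_class \<mu> 1) U B"
    and "class_on (drop_class \<mu> 2) U (lie_bracket UNIV F (\<lambda>q. c *\<^sub>C B q))"
    and "\<And>q. q \<in> M \<inter> U \<Longrightarrow> B' q = B q"
    and "\<And>q. q \<in> M \<inter> U \<Longrightarrow> B q \<in> ctangent_space M q"
    and "\<And>q. q \<in> M \<inter> U \<Longrightarrow> lie_bracket M L (\<lambda>q. c *\<^sub>C B' q) q = lie_bracket UNIV F (\<lambda>q. c *\<^sub>C B q) q"
    and "\<And>q. q \<in> M \<inter> U \<Longrightarrow> lie_bracket UNIV F (\<lambda>q. c *\<^sub>C B q) q \<in> ctangent_space M q"
    and "\<And>q. q \<in> U \<Longrightarrow> lie_bracket UNIV F (\<lambda>q. c *\<^sub>C B q) q = c *\<^sub>C lie_bracket UNIV F B q"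
proof -
  have o: "order_at_least 1 \<mu>" "order_at_least 1 (drop_class \<mu> 1)"
    using F(2) order_at_least_drop_class[of 1 1 \<mu>] by (cases \<mu>; simp add: numeral_2_eq_2)+
  have F0: "class_on (drop_class \<mu> 0) U F" using F(1) by (cases \<mu>) auto
  have F1: "class_on (drop_class \<mu> 1) U F" using class_on_drop_mono[OF F0, of 1] by simp
  have Fb: "class_on \<mu> U (\<lambda>q. cconj (F q))"
    by (rule class_on_bounded_linear[OF bounded_linear_cconj U F(1)])
  show B1: "class_on (drop_class \<mu> 1) U B"
    unfolding B_def by (rule class_on_lie_bracket[OF U o(1) Fb F(1)])
  have cB: "class_on (drop_class \<mu> 1) U (\<lambda>q. c *\<^sub>C B q)"
    by (rule class_on_bounded_linear[OF bounded_linear_cscale_right U B1])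
  show "class_on (drop_class \<mu> 2) U (lie_bracket UNIV F (\<lambda>q. c *\<^sub>C B q))"
    using class_on_lie_bracket[OF U o(2) cB F1] by (simp add: drop_class_drop_class numeral_2_eq_2)
  have d: "F differentiable (at q)" "(\<lambda>q. cconj (F q)) differentiable (at q)"
    "B differentiable (at q)" "(\<lambda>q. c *\<^sub>C B q) differentiable (at q)" if "q \<in> U" for q
    using class_on_imp_ck_on[OF F(1) o(1)] class_on_imp_ck_on[OF Fb o(1)]
      class_on_imp_ck_on[OF B1 o(2)] class_on_imp_ck_on[OF cB o(2)] that by simp_all
  have FL: "F q \<in> ctangent_space M q" "cconj (F q) \<in> ctangent_space M q"
    "cconj (L q) \<in> ctangent_space M q" if "q \<in> M \<inter> U" for q
    using L that ctangent_space_cconj[OF M] by auto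
  show B': "B' q = B q" if q: "q \<in> M \<inter> U" for q
    unfolding B_def B'_def using q L FL d[of q] by (intro lie_bracket_extension[OF _ U]) auto
  show B: "B q \<in> ctangent_space M q" if q: "q \<in> M \<inter> U" for q
    unfolding B_def using q FL d[of q] by (intro lie_bracket_in_ctangent_space[OF M _ U]) auto
  have cBt: "c *\<^sub>C B q \<in> ctangent_space M q" if "q \<in> M \<inter> U" for q
    using B[OF that] that ctangent_space_cscale[OF M] by blast
  show "lie_bracket M L (\<lambda>q. c *\<^sub>C B' q) q = lie_bracket UNIV F (\<lambda>q. c *\<^sub>C B q) q" if q: "q \<in> M \<inter> U" for q
    using q L FL cBt B' d[of q] by (intro lie_bracket_extension[OF _ U]) auto
  show "lie_bracket UNIV F (\<lambda>q. c *\<^sub>C B q) q \<in> ctangent_space M q" if q: "q \<in> M \<inter> U" for q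
    using q FL cBt d[of q] by (intro lie_bracket_in_ctangent_space[OF M _ U]) auto
  show "lie_bracket UNIV F (\<lambda>q. c *\<^sub>C B q) q = c *\<^sub>C lie_bracket UNIV F B q" if q: "q \<in> U" for q
    using d[OF q] by (intro lie_bracket_const_cscale_right)
qed

text \<open>Intersecting with an open set that cuts out V from \<open>M\<close> ensures that the
  extension agrees with \<open>L\<close> at all nearby points of \<open>M\<close>, as derivatives
  within \<open>M\<close> require.\<close>

lemma local_generator_extension:
  assumes "local_generator \<kappa> M V L" "p \<in> V"
  obtains U F where "open U" "p \<in> U" "M \<inter> U \<subseteq> V" "class_on (drop_class \<kappa> 1) U F"
    "\<And>q. q \<in> M \<inter> U \<Longrightarrow> F q = L q"
proof -
  obtain N where N: "open N" "V = M \<inter> N"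
    using assms(1) by (auto simp: local_generator_def openin_open)
  obtain U F where U: "open U" "p \<in> U" "class_on (drop_class \<kappa> 1) U F" "\<forall>q\<in>U \<inter> V. F q = L q"
    using assms unfolding local_generator_def class_on_subset_def by meson
  show thesis
    by (rule that[of "U \<inter> N" F]) (use U N assms(2) in \<open>auto intro: class_on_open_subset\<close>)
qed

lemma associated_frame_nth:
  fixes L :: "complex ^ 'n \<Rightarrow> (complex ^ 'n) \<times> (complex ^ 'n)"
  shows "associated_frame M L p $ 1 = L p"
    "associated_frame M L p $ 2 = cconj (L p)"
    "associated_frame M L p $ 3 = \<i> *\<^sub>C lie_bracket M L (\<lambda>p. cconj (L p)) p"
    "associated_frame M L p $ 4 = lie_bracket M L (\<lambda>p. \<i> *\<^sub>C lie_bracket M L (\<lambda>p. cconj (L p)) p) p"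
  by (simp_all add: associated_frame_def Let_def)

text \<open>The class drops from \<kappa> - 1 to \<kappa> - 2 for T and to \<kappa> - 3 for S, the
  least regular member of the frame. At each point the rank condition makes the four fields
  independent, and tangency of the brackets makes them span.\<close>

lemma local_frame_associated_frame:
  fixes M :: "(complex ^ 3) set"
  assumes \<kappa>: "order_at_least 3 \<kappa>" and M: "submanifold \<kappa> 4 M" and II: "general_class_II \<kappa> M"
    and L: "local_generator \<kappa> M V L"
  shows "local_frame (drop_class \<kappa> 3) M V (associated_frame M L)"
proof -
  have o2: "order_at_least 2 \<kappa>" "order_at_least 2 (drop_class \<kappa> 1)"
    using \<kappa> by (cases \<kappa>; simp)+
  let ?A = "associated_frame M L"
  have main: "(\<exists>U F. open U \<and> p \<in> U \<and> class_on (drop_class \<kappa> 3) U F \<and> (\<forall>q\<in>U \<inter> V. F q = ?A q $ i)) \<and>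
      inj (\<lambda>i. ?A p $ i) \<and> cplx.independent (range (\<lambda>i. ?A p $ i)) \<and>
      cplx.span (range (\<lambda>i. ?A p $ i)) = ctangent_space M p" if p: "p \<in> V" for p i
  proof -
    obtain U F where U: "open U" "p \<in> U" "M \<inter> U \<subseteq> V" "class_on (drop_class \<kappa> 1) U F"
      "\<And>q. q \<in> M \<inter> U \<Longrightarrow> F q = L q"
      using local_generator_extension[OF L p] by blast
    have VM: "V \<subseteq> M" using L by (auto simp: local_generator_def openin_open)
    then have pM: "p \<in> M \<inter> U" using p U by auto
    have Lt: "L q \<in> ctangent_space M q" if "q \<in> V" for q
      using L that by (auto simp: local_generator_def T10_def)
    have LtU: "\<forall>q\<in>M \<inter> U. L q \<in> ctangent_space M q" "\<forall>q\<in>M \<inter> U. F q = L q"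
      using Lt U(3,5) by auto
    define B where "B = lie_bracket UNIV F (\<lambda>q. cconj (F q))"
    note ext = bracket_extension[OF M o2(1) U(1) U(4) o2(2) LtU(2,1), folded B_def, simplified drop_class_drop_class]
    have A: "?A q $ 1 = F q" "?A q $ 2 = cconj (F q)" "?A q $ 3 = \<i> *\<^sub>C B q"
      "?A q $ 4 = lie_bracket UNIV F (\<lambda>q. \<i> *\<^sub>C B q) q" if "q \<in> M \<inter> U" for q
      using that U(5) ext(3)[of q] ext(5)[of q \<i>] by (simp_all add: associated_frame_nth)
    have "class_on (drop_class \<kappa> 3) U F"
      by (rule class_on_drop_mono[OF U(4)]) simp
    moreover have "class_on (drop_class \<kappa> 3) U (\<lambda>q. cconj (F q))"
      by (rule class_on_bounded_linear[OF bounded_linear_cconj U(1)]) fact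
    moreover have "class_on (drop_class \<kappa> 3) U (\<lambda>q. \<i> *\<^sub>C B q)"
    proof (rule class_on_bounded_linear[OF bounded_linear_cscale_right U(1)])
      have "class_on (drop_class \<kappa> 2) U B" using ext(1) by (simp add: numeral_2_eq_2)
      then show "class_on (drop_class \<kappa> 3) U B" by (rule class_on_drop_mono) simp
    qed
    moreover have "class_on (drop_class \<kappa> 3) U (lie_bracket UNIV F (\<lambda>q. \<i> *\<^sub>C B q))"
      using ext(2)[of \<i>] by (simp add: numeral_3_eq_3 numeral_2_eq_2)
    moreover have "q \<in> M \<inter> U" if "q \<in> U \<inter> V" for q using VM that by blast
    ultimately have "\<forall>i. \<exists>G. class_on (drop_class \<kappa> 3) U G \<and> (\<forall>q\<in>U \<inter> V. G q = ?A q $ i)"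
      unfolding forall_4
      by (intro conjI exI[of _ F] exI[of _ "\<lambda>q. cconj (F q)"] exI[of _ "\<lambda>q. \<i> *\<^sub>C B q"]
          exI[of _ "lie_bracket UNIV F (\<lambda>q. \<i> *\<^sub>C B q)"]) (simp_all add: A)
    then have smooth: "\<exists>U F. open U \<and> p \<in> U \<and> class_on (drop_class \<kappa> 3) U F \<and> (\<forall>q\<in>U \<inter> V. F q = ?A q $ i)"
      using U(1,2) by blast
    define C where "C = lie_bracket UNIV F B p"
    have A4: "?A p $ 4 = \<i> *\<^sub>C C" using A(4)[OF pM] ext(7)[of p \<i>] U(2) by (simp add: C_def)
    have R: "range (\<lambda>i. ?A p $ i) = {L p, cconj (L p), \<i> *\<^sub>C B p, \<i> *\<^sub>C C}"
      unfolding UNIV_4 using A[OF pM] A4 U(5)[OF pM] by auto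
    have "cplx.dim {L p, cconj (L p), lie_bracket M L (\<lambda>p. cconj (L p)) p,
        lie_bracket M L (lie_bracket M L (\<lambda>p. cconj (L p))) p} = 4"
      using II L p unfolding general_class_II_def Let_def by blast
    moreover have "lie_bracket M L (\<lambda>p. cconj (L p)) p = B p" using ext(3)[OF pM] .
    moreover have "lie_bracket M L (lie_bracket M L (\<lambda>p. cconj (L p))) p = C"
      using ext(5)[OF pM, of 1] by (simp add: C_def)
    ultimately have dim: "cplx.dim {L p, cconj (L p), B p, C} = 4" by simp
    \<comment> \<open>T and S carry a factor \<i> absent from the brackets in
      \<open>general_class_II\<close>. Scaling by - \<i> undoes it, so both quadruples have the same
      span.\<close>
    have i: "X \<in> cplx.span Z" if "\<i> *\<^sub>C X \<in> Z" for X :: "(complex ^ 3) \<times> (complex ^ 3)" and Z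
      using cplx.span_scale[OF cplx.span_base[OF that], of "- \<i>"] by simp
    have "cplx.span {L p, cconj (L p), B p, C} = cplx.span {L p, cconj (L p), \<i> *\<^sub>C B p, \<i> *\<^sub>C C}"
    proof (rule cplx.span_eq[THEN iffD2], intro conjI)
      show "{L p, cconj (L p), B p, C} \<subseteq> cplx.span {L p, cconj (L p), \<i> *\<^sub>C B p, \<i> *\<^sub>C C}"
        by (auto intro: cplx.span_base i)
      show "{L p, cconj (L p), \<i> *\<^sub>C B p, \<i> *\<^sub>C C} \<subseteq> cplx.span {L p, cconj (L p), B p, C}"
        by (auto intro!: cplx.span_base cplx.span_scale[OF cplx.span_base])
    qed
    then have dimR: "cplx.dim (range (\<lambda>i. ?A p $ i)) = 4"
      unfolding R using dim cplx.span_eq_dim by metis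
    have "range (\<lambda>i. ?A p $ i) \<subseteq> ctangent_space M p"
      using Lt[OF p] ctangent_space_cconj[OF M o2(1) _ Lt[OF p]] pM
        ctangent_space_cscale[OF M o2(1) _ ext(4)[OF pM]] ext(6)[OF pM, of \<i>] A4 A(4)[OF pM]
      unfolding R by auto
    \<comment> \<open>Four indices give at most four values while the dimension is 4; hence the
      values are distinct as well as independent.\<close>
    moreover have "card (range (\<lambda>i. ?A p $ i)) \<le> 4"
      using card_image_le[of "UNIV :: 4 set" "\<lambda>i. ?A p $ i"] by simp
    ultimately have *: "cplx.independent (range (\<lambda>i. ?A p $ i))" "card (range (\<lambda>i. ?A p $ i)) = 4"
        "cplx.span (range (\<lambda>i. ?A p $ i)) = ctangent_space M p"
      using cplx_independent_span_ctangent[OF M o2(1) _ _ _ dimR] pM by auto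
    moreover have "inj (\<lambda>i. ?A p $ i)" using *(2) by (intro eq_card_imp_inj_on) auto
    ultimately show ?thesis using smooth by blast
  qed
  then show ?thesis unfolding local_frame_def class_on_subset_def by blast
qed

text \<open>The matrix is sought point by point. Near a fixed point both generators extend to
  ambient C^2 fields, and the second is replaced by the multiple a F of the first extension, so that
  \<open>frame_change\<close> applies with an a defined on an open set.\<close>

lemma frames_reduce_to_G_II_initial:
  fixes M :: "(complex ^ 3) set"
  assumes \<kappa>: "order_at_least 3 \<kappa>" and M: "submanifold \<kappa> 4 M" and CR: "CR_generic M"
  shows "frames_reduce_to \<kappa> M G_II_initial"
proof -
  have o2: "order_at_least 2 \<kappa>" "order_at_least 2 (drop_class \<kappa> 1)"
    using \<kappa> by (cases \<kappa>; simp)+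
  have "\<exists>g. g \<in> G_II_initial \<and> associated_frame M L' p = mat_act g (associated_frame M L p)"
    if L: "local_generator \<kappa> M V L" and L': "local_generator \<kappa> M V L'" and p: "p \<in> V" for V L L' p
  proof -
    obtain U1 F where U1: "open U1" "p \<in> U1" "M \<inter> U1 \<subseteq> V" "class_on (drop_class \<kappa> 1) U1 F"
      "\<And>q. q \<in> M \<inter> U1 \<Longrightarrow> F q = L q"
      using local_generator_extension[OF L p] by blast
    obtain U2 F2 where U2: "open U2" "p \<in> U2" "M \<inter> U2 \<subseteq> V" "class_on (drop_class \<kappa> 1) U2 F2"
      "\<And>q. q \<in> M \<inter> U2 \<Longrightarrow> F2 q = L' q"
      using local_generator_extension[OF L' p] by blast
    have VM: "V \<subseteq> M" using L by (auto simp: local_generator_def openin_open)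
    have T: "L q \<in> T10 M q" "L q \<noteq> 0" "L' q \<in> T10 M q" "L' q \<noteq> 0" if "q \<in> V" for q
      using L L' that by (auto simp: local_generator_def)
    have "fst (L p) \<noteq> 0"
      using T10_rank_one[OF M o2(1) CR _ T(1,2)[OF p] T(1)[OF p]] p VM by blast
    \<comment> \<open>A coordinate of u that does not vanish at \<open>p\<close>; by continuity it
      serves as denominator on a neighbourhood.\<close>
    then obtain j where j: "fst (F p) $ j \<noteq> 0"
      using U1(2,5) p VM by (auto simp: vec_eq_iff)
    define f1 where "f1 q = fst (F q) $ j" for q
    define f2 where "f2 q = fst (F2 q) $ j" for q
    have bl: "bounded_linear (\<lambda>X :: (complex ^ 3) \<times> (complex ^ 3). fst X $ j)"
      by (rule bounded_linear_compose[OF bounded_linear_vec_nth bounded_linear_fst])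
    have ck1: "ck_on 2 U1 F" and ck2: "ck_on 2 U2 F2"
      using class_on_imp_ck_on[OF U1(4) o2(2)] class_on_imp_ck_on[OF U2(4) o2(2)] .
    have f1: "ck_on 2 U1 f1" and f2: "ck_on 2 U2 f2"
      unfolding f1_def[abs_def] f2_def[abs_def]
      by (rule ck_on_bounded_linear[OF bl] U1 U2 ck1 ck2)+
    have "continuous_on U1 f1" using ck_on_le[OF _ f1, of 0] by simp
    then have op: "open (U1 \<inter> f1 -` (- {0}))"
      using U1(1) by (intro continuous_open_preimage) auto
    define U where "U = (U1 \<inter> f1 -` (- {0})) \<inter> U2"
    have U: "open U" "p \<in> U" "U \<subseteq> U1" "U \<subseteq> U2" "\<And>q. q \<in> U \<Longrightarrow> f1 q \<noteq> 0" "M \<inter> U \<subseteq> V"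
      using op U1 U2 j by (auto simp: U_def f1_def)
    \<comment> \<open>On \<open>M\<close> this quotient is the proportionality factor of the two
      generators; off \<open>M\<close> it is merely a C^2 extension of it.\<close>
    define a where "a q = f2 q * inverse (f1 q)" for q
    have a: "ck_on 2 U a"
      unfolding a_def[abs_def] using U f1 f2
      by (intro ck_on_bilinear[OF bounded_bilinear_mult] ck_on_inverse) (auto intro: ck_on_subset)
    have F: "ck_on 2 U F" using ck1 U(3) by (rule ck_on_subset)
    have L'a: "L' q = a q *\<^sub>C F q" if q: "q \<in> M \<inter> U" for q
    proof -
      have qV: "q \<in> V" using q U(6) by auto
      obtain c where c: "L' q = c *\<^sub>C L q" "fst (L' q) = c *s fst (L q)"
        using T10_rank_one[OF M o2(1) CR _ T(1,2)[OF qV] T(3)[OF qV]] q by blast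
      have "F q = L q" "F2 q = L' q" using q U U1(5) U2(5) by auto
      then have "f2 q = c * f1 q" using c(2) by (simp add: f1_def f2_def)
      then have "a q = c" using U(5) q by (simp add: a_def)
      then show ?thesis using c \<open>F q = L q\<close> by simp
    qed
    define F' where "F' q = a q *\<^sub>C F q" for q
    have F': "ck_on 2 U F'"
      unfolding F'_def[abs_def] by (rule ck_on_bilinear[OF bounded_bilinear_cscale U(1) a F])
    have Lt: "\<forall>q\<in>M \<inter> U. L q \<in> ctangent_space M q" "\<forall>q\<in>M \<inter> U. L' q \<in> ctangent_space M q"
      using T U(6) by (auto simp: T10_def)
    have FL: "\<forall>q\<in>M \<inter> U. F q = L q" "\<forall>q\<in>M \<inter> U. F' q = L' q"
      using U1(5) U(3) L'a by (auto simp: F'_def)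
    have cF: "class_on (Ck 2) U F" "class_on (Ck 2) U F'" using F F' by (simp_all add: class_on_def)
    have pM: "p \<in> M \<inter> U" using p VM U by auto
    have ap: "a p \<noteq> 0" using L'a[OF pM] T(4)[OF p] by auto
    define B where "B = lie_bracket UNIV F (\<lambda>q. cconj (F q))"
    define B' where "B' = lie_bracket UNIV F' (\<lambda>q. cconj (F' q))"
    have A: "associated_frame M L p $ 1 = F p" "associated_frame M L p $ 2 = cconj (F p)"
      "associated_frame M L p $ 3 = \<i> *\<^sub>C B p"
      "associated_frame M L p $ 4 = lie_bracket UNIV F (\<lambda>q. \<i> *\<^sub>C B q) p"
      using bracket_extension(3,5)[OF M o2(1) U(1) cF(1) _ FL(1) Lt(1) pM] bspec[OF FL(1) pM]
      by (simp_all add: associated_frame_nth B_def)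
    have A': "associated_frame M L' p $ 1 = F' p" "associated_frame M L' p $ 2 = cconj (F' p)"
      "associated_frame M L' p $ 3 = \<i> *\<^sub>C B' p"
      "associated_frame M L' p $ 4 = lie_bracket UNIV F' (\<lambda>q. \<i> *\<^sub>C B' q) p"
      using bracket_extension(3,5)[OF M o2(1) U(1) cF(2) _ FL(2) Lt(2) pM] bspec[OF FL(2) pM]
      by (simp_all add: associated_frame_nth B'_def)
    obtain b c d e where ch:
      "\<i> *\<^sub>C B' p = b *\<^sub>C F p + cnj b *\<^sub>C cconj (F p) + (a p * cnj (a p)) *\<^sub>C (\<i> *\<^sub>C B p)"
      "lie_bracket UNIV F' (\<lambda>q. \<i> *\<^sub>C B' q) p = e *\<^sub>C F p + d *\<^sub>C cconj (F p) + c *\<^sub>C (\<i> *\<^sub>C B p) +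
        (a p * a p * cnj (a p)) *\<^sub>C lie_bracket UNIV F (\<lambda>q. \<i> *\<^sub>C B q) p"
      by (rule frame_change[OF U(1,2) F a])
        (rule that; unfold B_def B'_def F'_def[abs_def]; assumption)
    let ?g = "vector [vector [a p, 0, 0, 0], vector [0, cnj (a p), 0, 0],
        vector [b, cnj b, a p * cnj (a p), 0], vector [e, d, c, a p * a p * cnj (a p)]] :: complex ^ 4 ^ 4"
    have "?g \<in> G_II_initial" using ap by (simp add: G_II_initial_iff)
    moreover have "associated_frame M L' p = mat_act ?g (associated_frame M L p)"
      unfolding vec_eq_iff forall_4 mat_act_def
      using A A' ch by (simp add: sum_4 F'_def cconj_cscale)
    ultimately show ?thesis by blast
  qed
  \<comment> \<open>The reduction asks only for a matrix function on \<open>V\<close>, so the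
    matrices at the individual points may be chosen independently.\<close>
  then have "\<exists>g. \<forall>p\<in>V. g p \<in> G_II_initial \<and> associated_frame M L' p = mat_act (g p) (associated_frame M L p)"
    if "local_generator \<kappa> M V L \<and> local_generator \<kappa> M V L'" for V L L'
    using that by (intro bchoice) blast
  then show ?thesis
    unfolding frames_reduce_to_def using subgroup_G_II_initial closedin_G_II_initial by blast
qed

theorem mainTheorem2:
  fixes M :: "(complex ^ 3) set" and \<kappa> :: smoothness
  assumes "(\<exists>k\<ge>3. \<kappa> = Ck k) \<or> \<kappa> = Cinf \<or> \<kappa> = Comega"
    and "submanifold \<kappa> 4 M"
    and "connected M"
    and "CR_generic M"
    and "general_class_II \<kappa> M"
  shows "(\<forall>V L. local_generator \<kappa> M V L \<longrightarrow>
            local_frame (drop_class \<kappa> 3) M V (associated_frame M L)) \<and>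
         frames_reduce_to \<kappa> M G_II_initial \<and>
         submanifold Cinf 10 G_II_initial"
proof -
  have "order_at_least 3 \<kappa>" using assms(1) by auto
  then show ?thesis
    using assms local_frame_associated_frame frames_reduce_to_G_II_initial submanifold_G_II_initial
    by blast
qed

end
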